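(* Let $K\colon P\to\mathbf{SCpx}$ be a poset tower. The matrices $p_\ell^1\colon R_\ell\to G_\ell$ and $f_\ell^0\colon G_\ell\to G_{\ell-1}$ constructed by the algorithm PiRep (described in the context) form degreewise presentations of $C_\bullet(K)$ and lifts of $\partial_\bullet$ to the generators. That is, for every $\ell$ the sequence $0\leftarrow C_\ell(K)\xleftarrow{\alpha_\ell}G_\ell\xleftarrow{p_\ell^1}R_\ell$ is exact with $G_\ell,R_\ell$ projective, and $\alpha_{\ell-1}\circ f_\ell^0=\partial_\ell\circ\alpha_\ell$.
   Context: **Poset towers.** $P$ is a finite poset; $x\prec y$ means $x<y$ with no $z$ satisfying $x<z<y$. $\mathbf{SCpx}$ is the category of finite simplicial complexes and simplicial maps. A poset tower is a functor $K\colon P\to\mathbf{SCpx}$; vertices are labels, and the same label may occur at several grades (elements of $P$). $K_\ell(x)$ is the set of $\ell$-simplices of $K(x)$. The simplex generators are $\mathcal S=\{g_\sigma^x=(x,\sigma): x\in P,\ \sigma\in K(x)\setminus\bigcup_{y\prec x}\operatorname{im}K(y\prec x)\}$, and $\mathcal S_\ell$ is the subset with $\dim\sigma=\ell$. The edge events are $\mathcal C=\{c^{x\prec y}_{v\mapsto w}=(x,y,v,w): x\prec y,\ v\in K_0(x),\ w=K(x\prec y)(v)\in K_0(y),\ v\ne w\}$. **Modules.** A $P$-persistence module is a functor from $P$ to finite-dimensional $\mathbb F_2$-vector spaces. $C_\ell(K)(x)$ has basis $K_\ell(x)$ and $C_\ell(K)(x\le y)$ sends $\sigma$ to $K(x\le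 y)(\sigma)$ if this is an $\ell$-simplex and to $0$ otherwise; $\partial_\ell\colon C_\ell(K)\to C_{\ell-1}(K)$ is the simplicial boundary. $\operatorname{Proj}[x]$ is $\mathbb F_2$ at all $y\ge x$ and $0$ elsewhere, with identity maps between nonzero spaces; projective modules are finite direct sums of these. A morphism $\bigoplus_i\operatorname{Proj}[x_i]\to\bigoplus_j\operatorname{Proj}[y_j]$ is the same as a matrix $(\lambda_{ji})$ over $\mathbb F_2$ with $\lambda_{ji}=0$ unless $y_j\le x_i$. $G_\ell=\bigoplus_{g_\sigma^x\in\mathcal S_\ell}\operatorname{Proj}[x]$, so $G_\ell(x)$ has basis $\{g_\sigma^y\in\mathcal S_\ell: y\le x\}$, and $\alpha_\ell\colon G_\ell\to C_\ell(K)$ is defined by $\alpha_\ell(x)(g_\sigma^y)=K(y\le x)(\sigma)$ if $K(y\le x)(\sigma)\in K_\ell(x)$ and $0$ otherwise. **The algorithm PiRep (part relevant to $p^1$, $f^0$).** It maintains matrices $p^1,f^0$ over $\mathbb F_2$ for all degrees at once ($p_\ell^1,f_\ell^0$ are the parts belonging to $\ell$-simplices). Rows of $p^1$ and rows and columns of $f^0$ are indexed by simplex generators; columns of $p^1$ (relations) are indexed by graded identifiers $\mathsf r^x$, $x$ being the grade at which the relation is added. $R_\ell=\bigoplus\operatorname{Proj}[x]$ over all columns $\mathsf r^x$ of $p_\ell^1$. For each grade $x$ it keeps a set $L^x_{act}$ of pairs $(\sigma,g)$ with $g\in\mathcal S$, a graph $\mathcal G^x_{act}$ whose vertices are simplex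 generators together with a special vertex $\Omega$ and whose edges correspond to relations, and a spanning forest $\mathcal F^x_{act}$. The grades are processed in the order of a linear extension of $P$; at grade $x$: *Collapse(x)*: Set $L^x_{act}=\emptyset$. If $x$ is not minimal set $\mathcal G^x_{act}=\bigcup_{y\prec x}\mathcal F^y_{act}$, otherwise let $\mathcal G^x_{act}$ consist of the vertex $\Omega$. For all $y\prec x$ and all $(\sigma,g^z_\rho)\in L^y_{act}$: apply to the vertices of $\sigma$ the vertex map of $K(y\prec x)$ (given by $v\mapsto w$ if $c^{y\prec x}_{v\mapsto w}\in\mathcal C$, else $v\mapsto v$). If the result has no repeated vertices, add $(K(y\prec x)(\sigma),g^z_\rho)$ to $L^x_{act}$. Otherwise, if adding an edge between $\Omega$ and $g^z_\rho$ to $\mathcal G^x_{act}$ creates no cycle, add this edge and a new column $\mathsf r^x$ to $p^1$ with single nonzero entry in row $g^z_\rho$. *Generator(x)*: (1) For all $g^x_\sigma\in\mathcal S$ of grade $x$, in increasing order of simplex dimension: add $(\sigma,g^x_\sigma)$ to $L^x_{act}$, add the vertex $g^x_\sigma$ to $\mathcal G^x_{act}$, then find $(\tau_1,g_1),\dots,(\tau_k,g_k)\in L^x_{act}$ with $\sum_i\tau_i=\partial\sigma$ (one pair for each facet $\tau_i$ of $\sigma$) and add a column $g^x_\sigma$ to $f^0$ with entries $1$ exactly in rows $g_1,\dots,g_k$. (2) For every two pairs $(\sigma,g),(\sigma,g')\in L^x_{act}$ with the same simplex and $g\ne g'$: if adding an edge between $g$ and $g'$ to $\mathcal G^x_{act}$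 creates no cycle, add it and add a new column $\mathsf r^x$ to $p^1$ with entries $1$ exactly in rows $g,g'$; then (in either case) delete $(\sigma,g')$ from $L^x_{act}$. (3) Let $\mathcal F^x_{act}$ be a spanning forest of $\mathcal G^x_{act}$. (The remaining routines of PiRep do not modify $p^1$, $f^0$, $L_{act}$, $\mathcal G_{act}$, $\mathcal F_{act}$.) *)

theory Defs
  imports Complex_Main "HOL-Library.Z2" "HOL-Library.Function_Algebras"
begin

section \<open>Posets\<close>

definition covers :: "'p::order \<Rightarrow> 'p \<Rightarrow> bool" (infix "\<prec>" 50) where
  "x \<prec> y \<longleftrightarrow> x < y \<and> \<not> (\<exists>z. x < z \<and> z < y)"

definition linear_extension :: "'p::{finite,order} list \<Rightarrow> bool" where
  "linear_extension zs \<longleftrightarrow> distinct zs \<and> set zs = UNIV \<and> sorted_wrt (\<lambda>x y. \<not> y < x) zs"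


section \<open>Simplicial complexes and poset towers\<close>

text \<open>A simplex is the set of its vertices; every vertex of a complex spans a simplex of it.\<close>

definition finite_complex :: "'v set set \<Rightarrow> bool" where
  "finite_complex X \<longleftrightarrow> finite X \<and> (\<forall>\<sigma>\<in>X. finite \<sigma> \<and> \<sigma> \<noteq> {}) \<and>
     (\<forall>\<sigma>\<in>X. \<forall>\<tau>. \<tau> \<subseteq> \<sigma> \<and> \<tau> \<noteq> {} \<longrightarrow> \<tau> \<in> X)"

definition simplicial_map :: "'v set set \<Rightarrow> 'w set set \<Rightarrow> ('v \<Rightarrow> 'w) \<Rightarrow> bool" where
  "simplicial_map X Y f \<longleftrightarrow> (\<forall>\<sigma>\<in>X. f ` \<sigma> \<in> Y)"

text \<open>
  \<open>cpx K x\<close> is the complex \<open>K(x)\<close>, and \<open>vmap K x y\<close> is the vertex map of \<open>K(x \<le> y)\<close>; the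
  latter is only meaningful for \<open>x \<le> y\<close> and on vertices of \<open>K(x)\<close>.
\<close>

record ('p, 'v) tower =
  cpx :: "'p \<Rightarrow> 'v set set"
  vmap :: "'p \<Rightarrow> 'p \<Rightarrow> 'v \<Rightarrow> 'v"

definition poset_tower :: "('p::order, 'v) tower \<Rightarrow> bool" where
  "poset_tower K \<longleftrightarrow>
     (\<forall>x. finite_complex (cpx K x)) \<and>
     (\<forall>x y. x \<le> y \<longrightarrow> simplicial_map (cpx K x) (cpx K y) (vmap K x y)) \<and>
     (\<forall>x v. {v} \<in> cpx K x \<longrightarrow> vmap K x x v = v) \<and>
     (\<forall>x y z v. x \<le> y \<and> y \<le> z \<and> {v} \<in> cpx K x \<longrightarrow>
        vmap K y z (vmap K x y v) = vmap K x z v)"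

definition simp_map :: "('p, 'v) tower \<Rightarrow> 'p \<Rightarrow> 'p \<Rightarrow> 'v set \<Rightarrow> 'v set" where
  "simp_map K x y \<sigma> = vmap K x y ` \<sigma>"

text \<open>
  Degrees are integers, so that degree \<open>-1\<close> exists; it is zero because simplices are nonempty.
\<close>

definition simp_dim :: "'v set \<Rightarrow> int" where
  "simp_dim \<sigma> = int (card \<sigma>) - 1"

definition simplices :: "('p, 'v) tower \<Rightarrow> int \<Rightarrow> 'p \<Rightarrow> 'v set set" where
  "simplices K l x = {\<sigma> \<in> cpx K x. simp_dim \<sigma> = l}"

definition facets :: "'v set \<Rightarrow> 'v set set" where
  "facets \<sigma> = {\<tau>. \<tau> \<subseteq> \<sigma> \<and> \<tau> \<noteq> {} \<and> simp_dim \<tau> = simp_dim \<sigma> - 1}"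

type_synonym ('p, 'v) gen = "'p \<times> 'v set"

definition gens :: "('p::order, 'v) tower \<Rightarrow> ('p, 'v) gen set" where
  "gens K = {(x, \<sigma>). \<sigma> \<in> cpx K x - (\<Union>y\<in>{y. y \<prec> x}. simp_map K y x ` cpx K y)}"

definition gens_deg :: "('p::order, 'v) tower \<Rightarrow> int \<Rightarrow> ('p, 'v) gen set" where
  "gens_deg K l = {(x, \<sigma>) \<in> gens K. simp_dim \<sigma> = l}"

definition edge_events :: "('p::order, 'v) tower \<Rightarrow> ('p \<times> 'p \<times> 'v \<times> 'v) set" where
  "edge_events K =
     {(x, y, v, w). x \<prec> y \<and> {v} \<in> cpx K x \<and> w = vmap K x y v \<and> {w} \<in> cpx K y \<and> v \<noteq> w}"


section \<open>Persistence modules over the field with two elements\<close>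

definition vscale :: "bit \<Rightarrow> ('b \<Rightarrow> bit) \<Rightarrow> 'b \<Rightarrow> bit" where
  "vscale c v = (\<lambda>b. c * v b)"

global_interpretation F2: vector_space vscale
  by unfold_locales (auto simp: vscale_def fun_eq_iff algebra_simps)

definition linear_on :: "('a \<Rightarrow> bit) set \<Rightarrow> (('a \<Rightarrow> bit) \<Rightarrow> ('b \<Rightarrow> bit)) \<Rightarrow> bool" where
  "linear_on V f \<longleftrightarrow> (\<forall>u\<in>V. \<forall>v\<in>V. f (u + v) = f u + f v) \<and>
     (\<forall>c. \<forall>v\<in>V. f (vscale c v) = vscale c (f v))"

text \<open>The linear extension of a map \<open>\<phi>\<close> defined on a finite basis \<open>B\<close>, in coordinates.\<close>

definition lin_ext :: "'a set \<Rightarrow> ('a \<Rightarrow> 'b \<Rightarrow> bit) \<Rightarrow> ('a \<Rightarrow> bit) \<Rightarrow> 'b \<Rightarrow> bit" where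
  "lin_ext B \<phi> v = (\<Sum>b\<in>B. vscale (v b) (\<phi> b))"

definition basis_vec :: "'b \<Rightarrow> 'b \<Rightarrow> bit" where
  "basis_vec b = (\<lambda>c. of_bool (c = b))"

definition free_space :: "'b set \<Rightarrow> ('b \<Rightarrow> bit) set" where
  "free_space B = {v. \<forall>b. b \<notin> B \<longrightarrow> v b = 0}"

text \<open>
  The space at grade \<open>x\<close> is a subspace \<open>spc M x\<close> of an ambient coordinate space; \<open>trn M x y\<close> is the
  structure map for \<open>x \<le> y\<close>, only meaningful on \<open>spc M x\<close>.
\<close>

record ('p, 'a) pmod =
  spc :: "'p \<Rightarrow> ('a \<Rightarrow> bit) set"
  trn :: "'p \<Rightarrow> 'p \<Rightarrow> ('a \<Rightarrow> bit) \<Rightarrow> ('a \<Rightarrow> bit)"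

definition persistence_module :: "('p::order, 'a) pmod \<Rightarrow> bool" where
  "persistence_module M \<longleftrightarrow>
     (\<forall>x. F2.subspace (spc M x) \<and> (\<exists>B. finite B \<and> F2.span B = spc M x)) \<and>
     (\<forall>x y. x \<le> y \<longrightarrow> linear_on (spc M x) (trn M x y) \<and> trn M x y ` spc M x \<subseteq> spc M y) \<and>
     (\<forall>x. \<forall>v\<in>spc M x. trn M x x v = v) \<and>
     (\<forall>x y z. x \<le> y \<and> y \<le> z \<longrightarrow> (\<forall>v\<in>spc M x. trn M y z (trn M x y v) = trn M x z v))"

definition morphism ::
  "('p::order, 'a) pmod \<Rightarrow> ('p, 'b) pmod \<Rightarrow> ('p \<Rightarrow> ('a \<Rightarrow> bit) \<Rightarrow> ('b \<Rightarrow> bit)) \<Rightarrow> bool" where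
  "morphism M N \<phi> \<longleftrightarrow> persistence_module M \<and> persistence_module N \<and>
     (\<forall>x. linear_on (spc M x) (\<phi> x) \<and> \<phi> x ` spc M x \<subseteq> spc N x) \<and>
     (\<forall>x y. x \<le> y \<longrightarrow> (\<forall>v\<in>spc M x. \<phi> y (trn M x y v) = trn N x y (\<phi> x v)))"

definition isomorphic :: "('p::order, 'a) pmod \<Rightarrow> ('p, 'b) pmod \<Rightarrow> bool" where
  "isomorphic M N \<longleftrightarrow> (\<exists>\<phi>. morphism M N \<phi> \<and> (\<forall>x. bij_betw (\<phi> x) (spc M x) (spc N x)))"

text \<open>
  \<open>proj_space a\<close> and \<open>proj_map a\<close> are the spaces and structure maps of \<open>Proj[a]\<close>, and
  \<open>proj_sum I gr\<close> is the direct sum of the modules \<open>Proj[gr i]\<close> over \<open>i \<in> I\<close>, the coordinate \<open>v i\<close>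
  being the component of \<open>v\<close> in the \<open>i\<close>-th summand.
\<close>

definition proj_space :: "'p::order \<Rightarrow> 'p \<Rightarrow> bit set" where
  "proj_space a y = (if a \<le> y then UNIV else {0})"

definition proj_map :: "'p::order \<Rightarrow> 'p \<Rightarrow> 'p \<Rightarrow> bit \<Rightarrow> bit" where
  "proj_map a y z c = (if a \<le> y \<and> a \<le> z then c else 0)"

definition proj_sum :: "'i set \<Rightarrow> ('i \<Rightarrow> 'p::order) \<Rightarrow> ('p, 'i) pmod" where
  "proj_sum I gr =
     \<lparr>spc = (\<lambda>x. {v. (\<forall>i\<in>I. v i \<in> proj_space (gr i) x) \<and> (\<forall>i. i \<notin> I \<longrightarrow> v i = 0)}),
      trn = (\<lambda>x y v i. proj_map (gr i) x y (v i))\<rparr>"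

definition projective :: "('p::order, 'a) pmod \<Rightarrow> bool" where
  "projective M \<longleftrightarrow> (\<exists>(I :: nat set) gr. finite I \<and> isomorphic M (proj_sum I gr))"

text \<open>
  The map between direct sums of modules \<open>Proj[x]\<close> given by the submatrix of \<open>A\<close> with rows \<open>J\<close> and
  columns \<open>I\<close>. The same formula serves at every grade, since at grade \<open>x\<close> the coordinates of \<open>v\<close>
  belonging to summands not graded below \<open>x\<close> vanish.
\<close>

definition mat_map :: "'j set \<Rightarrow> 'i set \<Rightarrow> ('j \<Rightarrow> 'i \<Rightarrow> bit) \<Rightarrow> ('i \<Rightarrow> bit) \<Rightarrow> 'j \<Rightarrow> bit" where
  "mat_map J I A v = (\<lambda>j. if j \<in> J then \<Sum>i\<in>I. A j i * v i else 0)"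

text \<open>Exactness of \<open>0 \<leftarrow> C \<leftarrow> G \<leftarrow> R\<close>.\<close>

definition exact_presentation where
  "exact_presentation C \<alpha> G p R \<longleftrightarrow> morphism G C \<alpha> \<and> morphism R G p \<and>
     (\<forall>x. \<alpha> x ` spc G x = spc C x) \<and>
     (\<forall>x. p x ` spc R x = {v \<in> spc G x. \<alpha> x v = 0})"


section \<open>Chain modules and generators\<close>

definition chain_map_basis ::
  "('p, 'v) tower \<Rightarrow> int \<Rightarrow> 'p \<Rightarrow> 'p \<Rightarrow> 'v set \<Rightarrow> 'v set \<Rightarrow> bit" where
  "chain_map_basis K l x y \<sigma> =
     (if simp_map K x y \<sigma> \<in> simplices K l y then basis_vec (simp_map K x y \<sigma>) else 0)"

definition chain_module :: "('p, 'v) tower \<Rightarrow> int \<Rightarrow> ('p, 'v set) pmod" where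
  "chain_module K l =
     \<lparr>spc = (\<lambda>x. free_space (simplices K l x)),
      trn = (\<lambda>x y. lin_ext (simplices K l x) (chain_map_basis K l x y))\<rparr>"

definition boundary ::
  "('p, 'v) tower \<Rightarrow> int \<Rightarrow> 'p \<Rightarrow> ('v set \<Rightarrow> bit) \<Rightarrow> 'v set \<Rightarrow> bit" where
  "boundary K l x = lin_ext (simplices K l x) (\<lambda>\<sigma>. \<Sum>\<tau>\<in>facets \<sigma>. basis_vec \<tau>)"

definition gen_module :: "('p::order, 'v) tower \<Rightarrow> int \<Rightarrow> ('p, ('p, 'v) gen) pmod" where
  "gen_module K l = proj_sum (gens_deg K l) fst"

definition gen_map ::
  "('p::order, 'v) tower \<Rightarrow> int \<Rightarrow> 'p \<Rightarrow> (('p, 'v) gen \<Rightarrow> bit) \<Rightarrow> 'v set \<Rightarrow> bit" where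
  "gen_map K l x =
     lin_ext {g \<in> gens_deg K l. fst g \<le> x} (\<lambda>(y, \<sigma>). chain_map_basis K l y x \<sigma>)"


section \<open>Graphs\<close>

text \<open>
  Edges carry a label, so parallel edges are possible: forests of different grades may join the same
  two nodes by different relations. The edge with label \<open>r\<close> between \<open>a\<close> and \<open>b\<close> is \<open>(r, {a, b})\<close>.
\<close>

record ('n, 'r) graph =
  nodes :: "'n set"
  edges :: "('r \<times> 'n set) set"

definition cycle :: "('r \<times> 'n set) set \<Rightarrow> 'n list \<Rightarrow> ('r \<times> 'n set) list \<Rightarrow> bool" where
  "cycle E ns es \<longleftrightarrow> es \<noteq> [] \<and> set es \<subseteq> E \<and> length ns = length es \<and> distinct ns \<and> distinct es \<and>
     (\<forall>i<length es. snd (es ! i) = {ns ! i, ns ! (Suc i mod length es)})"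

definition creates_cycle :: "('r \<times> 'n set) set \<Rightarrow> 'r \<times> 'n set \<Rightarrow> bool" where
  "creates_cycle E e \<longleftrightarrow> (\<exists>ns es. cycle (insert e E) ns es \<and> e \<in> set es)"

definition connected_by :: "('r \<times> 'n set) set \<Rightarrow> ('n \<times> 'n) set" where
  "connected_by E = {(a, b). \<exists>r. (r, {a, b}) \<in> E}\<^sup>*"

definition spanning_forest :: "('n, 'r) graph \<Rightarrow> ('n, 'r) graph \<Rightarrow> bool" where
  "spanning_forest F G \<longleftrightarrow> nodes F = nodes G \<and> edges F \<subseteq> edges G \<and>
     (\<nexists>ns es. cycle (edges F) ns es) \<and> connected_by (edges F) = connected_by (edges G)"


section \<open>The algorithm PiRep\<close>

text \<open>
  A relation identifier is a grade together with a counter distinguishing relations of that grade.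
  The special node \<open>\<Omega>\<close> of the graphs is \<open>None\<close>. The component \<open>p1\<close> is indexed as \<open>p1 s row column\<close>,
  its set of columns being \<open>rels s\<close>; likewise for \<open>f0\<close>.
\<close>

type_synonym 'p rel_id = "'p \<times> nat"

type_synonym ('p, 'v) gen_graph = "(('p, 'v) gen option, 'p rel_id) graph"

record ('p, 'v) pirep_state =
  rels :: "'p rel_id set"
  p1 :: "('p, 'v) gen \<Rightarrow> 'p rel_id \<Rightarrow> bit"
  f0 :: "('p, 'v) gen \<Rightarrow> ('p, 'v) gen \<Rightarrow> bit"
  L_act :: "'p \<Rightarrow> ('v set \<times> ('p, 'v) gen) set"
  G_act :: "'p \<Rightarrow> ('p, 'v) gen_graph"
  F_act :: "'p \<Rightarrow> ('p, 'v) gen_graph"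

definition init_state :: "('p, 'v) pirep_state" where
  "init_state =
     \<lparr>rels = {}, p1 = (\<lambda>_ _. 0), f0 = (\<lambda>_ _. 0), L_act = (\<lambda>_. {}),
      G_act = (\<lambda>_. \<lparr>nodes = {}, edges = {}\<rparr>), F_act = (\<lambda>_. \<lparr>nodes = {}, edges = {}\<rparr>)\<rparr>"

text \<open>
  Every choice the algorithm leaves open is nondeterministic, so each step is a relation between the
  state before and the state after. \<open>steps\<close> performs one step for each list entry, in order.
\<close>

inductive steps :: "('a \<Rightarrow> 's \<Rightarrow> 's \<Rightarrow> bool) \<Rightarrow> 'a list \<Rightarrow> 's \<Rightarrow> 's \<Rightarrow> bool" for step where
  steps_Nil: "steps step [] s s"
| steps_Cons: "step a s s' \<Longrightarrow> steps step as s' s'' \<Longrightarrow> steps step (a # as) s s''"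

text \<open>
  Unless this creates a cycle, add an edge between \<open>a\<close> and \<open>b\<close> at grade \<open>x\<close> and a column with a fresh
  identifier. If \<open>a = \<Omega>\<close>, the column has its only entry in the row of \<open>b\<close>.
\<close>

definition try_relation ::
  "'p \<Rightarrow> ('p, 'v) gen option \<Rightarrow> ('p, 'v) gen option \<Rightarrow>
   ('p, 'v) pirep_state \<Rightarrow> ('p, 'v) pirep_state \<Rightarrow> bool" where
  "try_relation x a b s s' \<longleftrightarrow>
     (\<exists>n. (x, n) \<notin> rels s \<and>
        (let r = (x, n); e = (r, {a, b}); H = G_act s x in
         s' = (if creates_cycle (edges H) e then s
               else s\<lparr>rels := insert r (rels s),
                      p1 := (\<lambda>g r'. if r' = r then of_bool (Some g \<in> {a, b}) else p1 s g r'),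
                      G_act := (G_act s)(x := H\<lparr>edges := insert e (edges H)\<rparr>)\<rparr>)))"

definition event_map :: "('p::order, 'v) tower \<Rightarrow> 'p \<Rightarrow> 'p \<Rightarrow> 'v \<Rightarrow> 'v" where
  "event_map K y x v =
     (if \<exists>w. (y, x, v, w) \<in> edge_events K then THE w. (y, x, v, w) \<in> edge_events K else v)"

definition collapse_step ::
  "('p::order, 'v) tower \<Rightarrow> 'p \<Rightarrow> 'p \<times> 'v set \<times> ('p, 'v) gen \<Rightarrow>
   ('p, 'v) pirep_state \<Rightarrow> ('p, 'v) pirep_state \<Rightarrow> bool" where
  "collapse_step K x = (\<lambda>(y, \<sigma>, g) s s'.
     if inj_on (event_map K y x) \<sigma>
     then s' = s\<lparr>L_act := (L_act s)(x := insert (simp_map K y x \<sigma>, g) (L_act s x))\<rparr>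
     else try_relation x None (Some g) s s')"

definition collapse ::
  "('p::order, 'v) tower \<Rightarrow> 'p \<Rightarrow> ('p, 'v) pirep_state \<Rightarrow> ('p, 'v) pirep_state \<Rightarrow> bool" where
  "collapse K x s s' \<longleftrightarrow>
     (let H = (if \<exists>y. y \<prec> x
               then \<lparr>nodes = (\<Union>y\<in>{y. y \<prec> x}. nodes (F_act s y)),
                     edges = (\<Union>y\<in>{y. y \<prec> x}. edges (F_act s y))\<rparr>
               else \<lparr>nodes = {None}, edges = {}\<rparr>)
      in \<exists>as. distinct as \<and> set as = {(y, \<sigma>, g). y \<prec> x \<and> (\<sigma>, g) \<in> L_act s y} \<and>
           steps (collapse_step K x) as
             (s\<lparr>L_act := (L_act s)(x := {}), G_act := (G_act s)(x := H)\<rparr>) s')"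

text \<open>Here \<open>h \<tau>\<close> is the generator found for the facet \<open>\<tau>\<close>.\<close>

definition insert_generator ::
  "'p \<Rightarrow> 'v set \<Rightarrow> ('p, 'v) pirep_state \<Rightarrow> ('p, 'v) pirep_state \<Rightarrow> bool" where
  "insert_generator x \<sigma> s s' \<longleftrightarrow>
     (let L = insert (\<sigma>, (x, \<sigma>)) (L_act s x); H = G_act s x in
      \<exists>h. (\<forall>\<tau>\<in>facets \<sigma>. (\<tau>, h \<tau>) \<in> L) \<and>
        s' = s\<lparr>L_act := (L_act s)(x := L),
               G_act := (G_act s)(x := H\<lparr>nodes := insert (Some (x, \<sigma>)) (nodes H)\<rparr>),
               f0 := (\<lambda>g c. if c = (x, \<sigma>) then of_bool (g \<in> h ` facets \<sigma>) else f0 s g c)\<rparr>)"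

definition insert_generators ::
  "('p::order, 'v) tower \<Rightarrow> 'p \<Rightarrow> ('p, 'v) pirep_state \<Rightarrow> ('p, 'v) pirep_state \<Rightarrow> bool" where
  "insert_generators K x s s' \<longleftrightarrow>
     (\<exists>\<sigma>s. distinct \<sigma>s \<and> set \<sigma>s = {\<sigma>. (x, \<sigma>) \<in> gens K} \<and> sorted (map simp_dim \<sigma>s) \<and>
        steps (insert_generator x) \<sigma>s s s')"

definition merge_step ::
  "'p \<Rightarrow> ('p, 'v) pirep_state \<Rightarrow> ('p, 'v) pirep_state \<Rightarrow> bool" where
  "merge_step x s s' \<longleftrightarrow>
     (\<exists>\<sigma> g g' t. (\<sigma>, g) \<in> L_act s x \<and> (\<sigma>, g') \<in> L_act s x \<and> g \<noteq> g' \<and>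
        try_relation x (Some g) (Some g') s t \<and>
        s' = t\<lparr>L_act := (L_act t)(x := L_act t x - {(\<sigma>, g')})\<rparr>)"

definition merge_all ::
  "'p \<Rightarrow> ('p, 'v) pirep_state \<Rightarrow> ('p, 'v) pirep_state \<Rightarrow> bool" where
  "merge_all x s s' \<longleftrightarrow> (merge_step x)\<^sup>*\<^sup>* s s' \<and>
     (\<forall>\<sigma> g g'. (\<sigma>, g) \<in> L_act s' x \<and> (\<sigma>, g') \<in> L_act s' x \<longrightarrow> g = g')"

definition choose_forest ::
  "'p \<Rightarrow> ('p, 'v) pirep_state \<Rightarrow> ('p, 'v) pirep_state \<Rightarrow> bool" where
  "choose_forest x s s' \<longleftrightarrow>
     (\<exists>F. spanning_forest F (G_act s x) \<and> s' = s\<lparr>F_act := (F_act s)(x := F)\<rparr>)"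

definition process_grade ::
  "('p::order, 'v) tower \<Rightarrow> 'p \<Rightarrow> ('p, 'v) pirep_state \<Rightarrow> ('p, 'v) pirep_state \<Rightarrow> bool" where
  "process_grade K x =
     collapse K x OO insert_generators K x OO merge_all x OO choose_forest x"

definition pirep ::
  "('p::{finite,order}, 'v) tower \<Rightarrow> 'p list \<Rightarrow> ('p, 'v) pirep_state \<Rightarrow> bool" where
  "pirep K zs s \<longleftrightarrow> linear_extension zs \<and> steps (process_grade K) zs init_state s"

text \<open>
  The degree-\<open>l\<close> parts of \<open>p1\<close> and \<open>f0\<close>. A column of \<open>p1\<close> belongs to degree \<open>l\<close> if it has a nonzero
  entry in the row of a generator of an \<open>l\<close>-simplex.
\<close>

definition rels_deg ::
  "('p::order, 'v) tower \<Rightarrow> ('p, 'v) pirep_state \<Rightarrow> int \<Rightarrow> 'p rel_id set" where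
  "rels_deg K s l = {r \<in> rels s. \<exists>g\<in>gens_deg K l. p1 s g r \<noteq> 0}"

definition rel_module ::
  "('p::order, 'v) tower \<Rightarrow> ('p, 'v) pirep_state \<Rightarrow> int \<Rightarrow> ('p, 'p rel_id) pmod" where
  "rel_module K s l = proj_sum (rels_deg K s l) fst"

definition p1_map ::
  "('p::order, 'v) tower \<Rightarrow> ('p, 'v) pirep_state \<Rightarrow> int \<Rightarrow>
   'p \<Rightarrow> ('p rel_id \<Rightarrow> bit) \<Rightarrow> ('p, 'v) gen \<Rightarrow> bit" where
  "p1_map K s l x = mat_map (gens_deg K l) (rels_deg K s l) (p1 s)"

definition f0_map ::
  "('p::order, 'v) tower \<Rightarrow> ('p, 'v) pirep_state \<Rightarrow> int \<Rightarrow>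
   'p \<Rightarrow> (('p, 'v) gen \<Rightarrow> bit) \<Rightarrow> ('p, 'v) gen \<Rightarrow> bit" where
  "f0_map K s l x = mat_map (gens_deg K (l - 1)) (gens_deg K l) (f0 s)"

end

theory Submission
  imports Defs
begin

text \<open>
  At a grade \<open>x\<close> every generator born below \<open>x\<close> has a class: its image simplex in \<open>K(x)\<close> or, if the
  image is degenerate, the class of \<open>\<Omega>\<close>. The kernel of \<open>gen_map\<close> at \<open>x\<close> is spanned by the
  differences of nodes of equal class, with \<open>\<Omega>\<close> counted as \<open>0\<close>. The algorithm keeps two
  invariants: a column of \<open>p1\<close> joins two nodes which have the same class at its grade, hence also
  later, and at each finished grade nodes of the same class are connected in the forest, so that
  their difference telescopes to a sum of columns. An edge refused because it closes a cycle, or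
  dropped from the graph when the forest is chosen, joins nodes that stay connected without it.
  The list \<open>L_act\<close> names for each simplex of \<open>K(x)\<close> a node of its class; hence a column of \<open>f0\<close>
  maps to the boundary of its simplex at its own grade, and later by naturality.
\<close>

text \<open>The algorithm is a relation with open choices, so two things are needed: what every run
  computes, and that a run exists for each linear extension. The same invariants give both.

  The graph is shared by all degrees, and the component of \<Omega> can contain generators of
  several dimensions, so a path may leave degree \<open>l\<close>. This does no harm: unit vectors
  of other degrees are sent to 0, as \<Omega> is, and a column outside degree \<open>l\<close>
  contributes nothing.

  Linear algebra and algorithm meet in only three predicates, \<open>sound_relations\<close>,
  \<open>complete_relations\<close> and \<open>boundary_column\<close>. They describe the matrices
  through classes of nodes and do not mention the lists and graphs of the run. These lists and
  graphs enter only the invariants from which the three predicates are derived.\<close>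

text \<open>These simp rules rewrite sums and products of bits to bitwise operations, for which the field
  lemmas are not available.\<close>

declare add_bit_eq_xor [simp del] mult_bit_eq_and [simp del]

section \<open>Step sequences and vector spaces over the field with two elements\<close>

text \<open>The collapse reads data only from the grades covered by the current one; this brings
  every generator born strictly below within reach of such a grade.\<close>

lemma covers_between:
  fixes x y :: "'p::{finite,order}"
  assumes "x < y"
  shows "\<exists>z. x \<le> z \<and> z \<prec> y"
proof -
  obtain z where z: "z \<in> {z. x \<le> z \<and> z < y}" "\<forall>b\<in>{z. x \<le> z \<and> z < y}. z \<le> b \<longrightarrow> z = b"
    using finite_has_maximal[of "{z. x \<le> z \<and> z < y}"] assms by auto
  then have "\<not> (\<exists>w. z < w \<and> w < y)"
    by (metis (mono_tags, lifting) mem_Collect_eq less_imp_le order_trans order_less_irrefl)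
  with z show ?thesis
    by (auto simp: covers_def)
qed

text \<open>The invariant depends on the processed prefix, and the step case sees the whole
  decomposition of the list. That is how the order of the list can be used: that of the linear
  extension, or that of dimensions.\<close>

lemma steps_prefix_invariant:
  assumes "steps step xs s s'" and "I [] s"
    and step: "\<And>as a bs s s'. xs = as @ a # bs \<Longrightarrow> I as s \<Longrightarrow> step a s s' \<Longrightarrow> I (as @ [a]) s'"
  shows "I xs s'"
proof -
  have "I xs s'" if "steps step bs s s'" "xs = as @ bs" "I as s" for as bs s
    using that
  proof (induction arbitrary: as rule: steps.induct)
    case (steps_Cons a s s' bs s'')
    then show ?case
      using step by (metis append.assoc append_Cons append_Nil)
  qed auto
  from this[of xs s "[]"] assms(1,2) show ?thesis by simp
qed

text \<open>The invariant is carried along because a step is possible only in states that satisfy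
  it.\<close>

lemma steps_total:
  assumes "I [] s"
    and step: "\<And>as a bs s s'. xs = as @ a # bs \<Longrightarrow> I as s \<Longrightarrow> step a s s' \<Longrightarrow> I (as @ [a]) s'"
    and total: "\<And>as a bs s. xs = as @ a # bs \<Longrightarrow> I as s \<Longrightarrow> \<exists>s'. step a s s'"
  shows "\<exists>s'. steps step xs s s'"
proof -
  have "\<exists>s'. steps step bs s s'" if "xs = as @ bs" "I as s" for as bs s
    using that
  proof (induction bs arbitrary: as s)
    case Nil
    show ?case by (blast intro: steps_Nil)
  next
    case (Cons a bs)
    obtain s1 where s1: "step a s s1"
      using total[OF Cons.prems] by blast
    from Cons.IH[of "as @ [a]" s1] step[OF Cons.prems s1] Cons.prems(1)
    obtain s2 where "steps step bs s1 s2" by auto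
    with s1 show ?case by (blast intro: steps_Cons)
  qed
  from this[of "[]" xs s] assms(1) show ?thesis by simp
qed

section \<open>Linear algebra in coordinates over the field with two elements\<close>

lemma sum_fun_apply: "(\<Sum>i\<in>I. F i) c = (\<Sum>i\<in>I. F i c)"
  for F :: "'i \<Rightarrow> 'c \<Rightarrow> 'b::comm_monoid_add"
  by (induction I rule: infinite_finite_induct) auto

lemma vscale_apply: "vscale c v b = c * v b"
  by (simp add: vscale_def)

lemma lin_ext_apply: "lin_ext B \<phi> v c = (\<Sum>b\<in>B. v b * \<phi> b c)"
  by (simp add: lin_ext_def sum_fun_apply vscale_def)

text \<open>The index set may vary with the coordinate \<open>c\<close>, so that matrix maps fit:
  outside their rows they are given by the empty sum.\<close>

lemma linear_onI_sum:
  assumes "\<And>v c. v \<in> V \<Longrightarrow> f v c = (\<Sum>i\<in>I c. v i * F i c)"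
    and "F2.subspace V"
  shows "linear_on V f"
proof -
  have "f (u + v) = f u + f v" if "u \<in> V" "v \<in> V" for u v
    using that F2.subspace_add[OF assms(2) that]
    by (simp add: fun_eq_iff assms(1) sum.distrib algebra_simps)
  moreover have "f (vscale c v) = vscale c (f v)" if "v \<in> V" for c v
    using that F2.subspace_scale[OF assms(2) that, of c]
    by (simp add: fun_eq_iff assms(1) vscale_apply sum_distrib_left algebra_simps)
  ultimately show ?thesis by (simp add: linear_on_def)
qed

lemma subspace_linear_image:
  assumes "F2.subspace V" "linear_on V f"
  shows "F2.subspace (f ` V)"
proof (rule F2.subspaceI)
  have "f (vscale 0 0) = vscale 0 (f 0)"
    using assms F2.subspace_0[OF assms(1)] unfolding linear_on_def by blast
  then have "f 0 = 0" by simp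
  then show "0 \<in> f ` V" using F2.subspace_0[OF assms(1)] by (metis imageI)
qed (use assms F2.subspace_add[OF assms(1)] F2.subspace_scale[OF assms(1)] in
  \<open>auto simp: linear_on_def image_iff; metis\<close>)+

lemma bit_add_self [simp]: "a + a = (0::bit)"
  by (cases a) auto

text \<open>The inner sum on the left is the coefficient at \<tau> of the image of \<open>v\<close>
  when each index is sent to its class and \<open>None\<close> counts as 0; the outer sum applies a
  linear map with values \<open>F\<close> to that image. All later composites of linear maps through
  classes are computed this way: functoriality, naturality, the kernel and the boundary.\<close>

lemma sum_by_class:
  fixes v :: "'i \<Rightarrow> bit"
  assumes "finite S" and "\<And>i. i \<in> I \<Longrightarrow> v i \<noteq> 0 \<Longrightarrow> c i \<in> insert None (Some ` S)"
  shows "(\<Sum>\<tau>\<in>S. (\<Sum>i\<in>I. v i * of_bool (c i = Some \<tau>)) * F \<tau>) =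
    (\<Sum>i\<in>I. v i * (case c i of None \<Rightarrow> 0 | Some \<tau> \<Rightarrow> F \<tau>))"
proof -
  have "(\<Sum>\<tau>\<in>S. (\<Sum>i\<in>I. v i * of_bool (c i = Some \<tau>)) * F \<tau>) =
      (\<Sum>i\<in>I. \<Sum>\<tau>\<in>S. v i * of_bool (c i = Some \<tau>) * F \<tau>)"
    by (subst sum.swap) (simp add: sum_distrib_right)
  also have "\<dots> = (\<Sum>i\<in>I. v i * (case c i of None \<Rightarrow> 0 | Some \<tau> \<Rightarrow> F \<tau>))"
  proof (rule sum.cong)
    fix i assume i: "i \<in> I"
    show "(\<Sum>\<tau>\<in>S. v i * of_bool (c i = Some \<tau>) * F \<tau>) =
        v i * (case c i of None \<Rightarrow> 0 | Some \<tau> \<Rightarrow> F \<tau>)"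
    proof (cases "v i = 0 \<or> c i = None")
      case False
      then obtain \<tau> where \<tau>: "c i = Some \<tau>" "\<tau> \<in> S" using assms(2)[OF i] by auto
      have "(\<Sum>\<tau>\<in>S. v i * of_bool (c i = Some \<tau>) * F \<tau>) = (\<Sum>\<tau>'\<in>S. if \<tau>' = \<tau> then v i * F \<tau> else 0)"
        by (rule sum.cong) (auto simp: \<tau>)
      with \<tau> assms(1) show ?thesis by simp
    qed auto
  qed simp
  finally show ?thesis .
qed

lemma free_spaceD: "v \<in> free_space B \<Longrightarrow> b \<notin> B \<Longrightarrow> v b = 0"
  by (simp add: free_space_def)

lemma subspace_free_space: "F2.subspace (free_space B)"
  by (rule F2.subspaceI) (auto simp: free_space_def vscale_def)

lemma free_space_span:
  assumes "finite B"
  shows "F2.span (basis_vec ` B) = free_space B"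
proof
  show "F2.span (basis_vec ` B) \<subseteq> free_space B"
    by (rule F2.span_minimal[OF _ subspace_free_space]) (auto simp: free_space_def basis_vec_def)
next
  show "free_space B \<subseteq> F2.span (basis_vec ` B)"
  proof
    fix v assume v: "v \<in> free_space B"
    have "v = (\<Sum>b\<in>B. vscale (v b) (basis_vec b))"
    proof
      fix c
      have "(\<Sum>b\<in>B. vscale (v b) (basis_vec b) c) = (\<Sum>b\<in>B. if b = c then v c else 0)"
        by (rule sum.cong) (auto simp: vscale_def basis_vec_def)
      then show "v c = (\<Sum>b\<in>B. vscale (v b) (basis_vec b)) c"
        using v assms by (auto simp: sum_fun_apply free_space_def)
    qed
    also have "\<dots> \<in> F2.span (basis_vec ` B)"
      by (intro F2.span_sum F2.span_scale F2.span_base) auto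
    finally show "v \<in> F2.span (basis_vec ` B)" .
  qed
qed

section \<open>Direct sums of the modules Proj\<close>

lemma spc_proj_sum: "spc (proj_sum I gr) x = free_space {i \<in> I. gr i \<le> x}"
proof -
  have "proj_space (gr i) x = {c. \<not> gr i \<le> x \<longrightarrow> c = 0}" for i
    by (auto simp: proj_space_def)
  then show ?thesis by (auto simp: proj_sum_def free_space_def)
qed

lemma trn_proj_sum:
  assumes "v \<in> spc (proj_sum I gr) x" and "x \<le> y"
  shows "trn (proj_sum I gr) x y v = v"
proof
  fix i
  show "trn (proj_sum I gr) x y v i = v i"
    using assms(1) order_trans[OF _ assms(2), of "gr i"]
    unfolding spc_proj_sum by (auto simp: proj_sum_def proj_map_def free_space_def)
qed

lemma spc_proj_sum_mono: "x \<le> y \<Longrightarrow> spc (proj_sum I gr) x \<subseteq> spc (proj_sum I gr) y"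
  by (auto simp: spc_proj_sum free_space_def dest: order_trans)

lemma persistence_module_proj_sum:
  fixes gr :: "'i \<Rightarrow> 'p::order"
  assumes "finite I"
  shows "persistence_module (proj_sum I gr)"
proof -
  have fin: "\<exists>B. finite B \<and> F2.span B = spc (proj_sum I gr) x" for x
    using free_space_span[of "{i \<in> I. gr i \<le> x}"] assms
    by (intro exI[of _ "basis_vec ` {i \<in> I. gr i \<le> x}"]) (simp add: spc_proj_sum)
  have sub: "F2.subspace (spc (proj_sum I gr) x)" for x
    by (simp add: spc_proj_sum subspace_free_space)
  have lin: "linear_on (spc (proj_sum I gr) x) (trn (proj_sum I gr) x y)" if "x \<le> y" for x y
    using F2.subspace_add[OF sub] F2.subspace_scale[OF sub]
    by (simp add: linear_on_def trn_proj_sum[OF _ that])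
  show ?thesis
    unfolding persistence_module_def
  proof (intro conjI allI impI ballI)
    fix x y :: 'p and v
    assume xy: "x \<le> y"
    show "trn (proj_sum I gr) x y ` spc (proj_sum I gr) x \<subseteq> spc (proj_sum I gr) y"
      using spc_proj_sum_mono[OF xy, of I gr] trn_proj_sum[OF _ xy, of _ I gr] by auto
  next
    fix x v
    assume "v \<in> spc (proj_sum I gr) x"
    then show "trn (proj_sum I gr) x x v = v" by (rule trn_proj_sum) simp
  next
    fix x y z :: 'p and v
    assume xyz: "x \<le> y \<and> y \<le> z" and v: "v \<in> spc (proj_sum I gr) x"
    then have "v \<in> spc (proj_sum I gr) y" "x \<le> z"
      using spc_proj_sum_mono by (blast, auto)
    with xyz v show "trn (proj_sum I gr) y z (trn (proj_sum I gr) x y v) = trn (proj_sum I gr) x z v"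
      by (simp add: trn_proj_sum)
  qed (use fin sub lin in blast)+
qed

text \<open>The definition of \<open>projective\<close> admits only sets of natural numbers as index
  sets, so the summands are renumbered along an enumeration of \<open>I\<close>.\<close>

lemma projective_proj_sum:
  fixes gr :: "'i \<Rightarrow> 'p::order"
  assumes "finite I"
  shows "projective (proj_sum I gr)"
proof -
  obtain h where h: "bij_betw h {..<card I} I"
    using ex_bij_betw_nat_finite[OF assms] by (auto simp: atLeast0LessThan)
  let ?n = "card I"
  let ?J = "{..<card I}"
  let ?N = "proj_sum ?J (gr \<circ> h)"
  define \<phi> :: "'p \<Rightarrow> ('i \<Rightarrow> bit) \<Rightarrow> nat \<Rightarrow> bit"
    where "\<phi> x v k = (if k < ?n then v (h k) else 0)" for x v k
  define \<psi> :: "(nat \<Rightarrow> bit) \<Rightarrow> 'i \<Rightarrow> bit"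
    where "\<psi> w i = (if i \<in> I then w (the_inv_into ?J h i) else 0)" for w i
  have hI: "h k \<in> I" if "k < ?n" for k
    using h that by (auto simp: bij_betw_def)
  have inv: "the_inv_into ?J h i < ?n" "h (the_inv_into ?J h i) = i" if "i \<in> I" for i
    using h that the_inv_into_into[of h ?J i ?J] f_the_inv_into_f[of h ?J i]
    by (auto simp: bij_betw_def)
  have inv': "the_inv_into ?J h (h k) = k" if "k < ?n" for k
    using h that by (auto simp: bij_betw_def the_inv_into_f_f)
  have maps: "\<phi> x v \<in> spc ?N x" if "v \<in> spc (proj_sum I gr) x" for x v
    using that by (auto simp: spc_proj_sum free_space_def \<phi>_def)
  have maps': "\<psi> w \<in> spc (proj_sum I gr) x" if "w \<in> spc ?N x" for x w
    using that inv by (auto simp: spc_proj_sum free_space_def \<psi>_def)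
  have "\<psi> (\<phi> x v) = v" if "v \<in> spc (proj_sum I gr) x" for x v
    using that inv by (auto simp: fun_eq_iff \<psi>_def \<phi>_def spc_proj_sum free_space_def)
  moreover have "\<phi> x (\<psi> w) = w" if "w \<in> spc ?N x" for x w
    using that inv' hI by (auto simp: fun_eq_iff \<psi>_def \<phi>_def spc_proj_sum free_space_def)
  ultimately have "bij_betw (\<phi> x) (spc (proj_sum I gr) x) (spc ?N x)" for x
    using maps maps' by (intro bij_betw_byWitness[where f' = \<psi>]) auto
  moreover have "linear_on V (\<phi> x)" for V x
    by (auto simp: linear_on_def \<phi>_def fun_eq_iff vscale_def)
  then have "morphism (proj_sum I gr) ?N \<phi>"
    unfolding morphism_def
    using maps assms by (auto simp: persistence_module_proj_sum trn_proj_sum \<phi>_def[abs_def])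
  ultimately show ?thesis
    unfolding projective_def isomorphic_def by blast
qed

section \<open>Matrix maps between such sums\<close>

lemma mat_map_apply: "j \<in> J \<Longrightarrow> mat_map J I A v j = (\<Sum>i\<in>I. v i * A j i)"
  by (simp add: mat_map_def mult.commute)

lemma linear_on_mat_map:
  assumes "F2.subspace V"
  shows "linear_on V (mat_map J I A)"
proof (rule linear_onI_sum[OF _ assms])
  show "mat_map J I A v c = (\<Sum>i\<in>(if c \<in> J then I else {}). v i * A c i)" for v c
    by (simp add: mat_map_def mult.commute)
qed

text \<open>At grade \<open>x\<close> only columns with \<open>gr i \<le> x\<close> carry a
  coefficient, and by \<open>A\<close> their nonzero entries lie in rows with
  \<open>gr' j \<le> gr i \<le> x\<close>. Naturality is immediate, as the structure maps leave all
  coordinates unchanged.\<close>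

lemma morphism_mat_map:
  fixes gr :: "'i \<Rightarrow> 'p::order"
  assumes "finite I" "finite J" and A: "\<And>i j. i \<in> I \<Longrightarrow> j \<in> J \<Longrightarrow> A j i \<noteq> 0 \<Longrightarrow> gr' j \<le> gr i"
  shows "morphism (proj_sum I gr) (proj_sum J gr') (\<lambda>x. mat_map J I A)"
proof -
  have "mat_map J I A v \<in> spc (proj_sum J gr') x" if v: "v \<in> spc (proj_sum I gr) x" for x v
  proof -
    have "mat_map J I A v j = 0" if "\<not> (j \<in> J \<and> gr' j \<le> x)" for j
    proof (cases "j \<in> J")
      case True
      have "v i * A j i = 0" if "i \<in> I" for i
        using v A[OF that True] \<open>\<not> (j \<in> J \<and> gr' j \<le> x)\<close> True
        by (cases "gr i \<le> x") (auto simp: spc_proj_sum free_space_def dest: order_trans)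
      then show ?thesis using True by (simp add: mat_map_apply del: mult_eq_0_iff)
    qed (simp add: mat_map_def)
    then show ?thesis by (auto simp: spc_proj_sum free_space_def)
  qed
  then show ?thesis
    unfolding morphism_def using assms
    by (auto simp: persistence_module_proj_sum trn_proj_sum spc_proj_sum subspace_free_space
        intro!: linear_on_mat_map)
qed

section \<open>Facets under a vertex map\<close>

lemma facets_eq:
  assumes "finite \<sigma>" "\<sigma> \<noteq> {}"
  shows "facets \<sigma> = {\<tau>. \<exists>a\<in>\<sigma>. \<tau> = \<sigma> - {a} \<and> \<tau> \<noteq> {}}"
proof -
  have "\<exists>a\<in>\<sigma>. \<tau> = \<sigma> - {a}" if "\<tau> \<subseteq> \<sigma>" "int (card \<tau>) = int (card \<sigma>) - 1" for \<tau>
  proof -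
    have "card (\<sigma> - \<tau>) = 1"
      using that assms by (simp add: card_Diff_subset finite_subset card_gt_0_iff)
    then obtain a where "\<sigma> - \<tau> = {a}" by (auto simp: card_1_singleton_iff)
    with that(1) show ?thesis by (intro bexI[of _ a]) auto
  qed
  moreover have "int (card (\<sigma> - {a})) = int (card \<sigma>) - 1" if "a \<in> \<sigma>" for a
    using that assms card_Suc_Diff1[of \<sigma> a] by simp
  ultimately show ?thesis
    unfolding facets_def simp_dim_def by auto
qed

lemma finite_facets: "finite \<sigma> \<Longrightarrow> finite (facets \<sigma>)"
  by (rule finite_subset[of _ "Pow \<sigma>"]) (auto simp: facets_def)

text \<open>If \<open>f\<close> identifies \<open>a \<noteq> b\<close>, only the facets omitting \<open>a\<close> or \<open>b\<close> can survive, and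
  these two have the same image.\<close>

lemma facets_image_parity:
  assumes "finite \<sigma>" "\<sigma> \<noteq> {}"
  shows "(\<Sum>\<tau>\<in>facets \<sigma>. of_bool (card (f ` \<tau>) = card \<tau> \<and> f ` \<tau> = \<rho>)) =
    (of_bool (card (f ` \<sigma>) = card \<sigma> \<and> \<rho> \<in> facets (f ` \<sigma>)) :: bit)"
proof (cases "card (f ` \<sigma>) = card \<sigma>")
  case True
  then have inj: "inj_on f \<sigma>" by (rule eq_card_imp_inj_on[OF assms(1)])
  have facets: "facets (f ` \<sigma>) = (`) f ` facets \<sigma>"
  proof -
    have "f ` \<sigma> - {f a} = f ` (\<sigma> - {a})" if "a \<in> \<sigma>" for a
      using inj that by (auto simp: inj_on_def)
    then show ?thesis
      using assms by (simp add: facets_eq) (auto simp: image_iff)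
  qed
  have "inj_on ((`) f) (facets \<sigma>)"
    using inj by (auto simp: inj_on_def facets_def inj_on_image_eq_iff[OF inj])
  then have "(\<Sum>\<tau>\<in>facets \<sigma>. of_bool (f ` \<tau> = \<rho>)) = (\<Sum>\<tau>\<in>facets (f ` \<sigma>). of_bool (\<tau> = \<rho>) :: bit)"
    by (simp add: facets sum.reindex)
  also have "\<dots> = of_bool (\<rho> \<in> facets (f ` \<sigma>))"
    using assms by (simp add: of_bool_def finite_facets)
  moreover have "card (f ` \<tau>) = card \<tau>" if "\<tau> \<in> facets \<sigma>" for \<tau>
    using that inj by (auto simp: facets_def intro!: card_image intro: inj_on_subset)
  ultimately show ?thesis using True by simp
next
  case False
  then have "\<not> inj_on f \<sigma>" using card_image by blast
  then obtain a b where ab: "a \<in> \<sigma>" "b \<in> \<sigma>" "a \<noteq> b" "f a = f b" by (auto simp: inj_on_def)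
  let ?F = "\<lambda>\<tau>. of_bool (card (f ` \<tau>) = card \<tau> \<and> f ` \<tau> = \<rho>) :: bit"
  have "?F \<tau> = 0" if "\<tau> \<in> facets \<sigma> - {\<sigma> - {a}, \<sigma> - {b}}" for \<tau>
  proof -
    have \<tau>: "a \<in> \<tau>" "b \<in> \<tau>" "finite \<tau>"
      using that assms ab by (auto simp: facets_eq)
    then have "card (f ` \<tau>) \<noteq> card \<tau>"
      using ab eq_card_imp_inj_on[OF \<tau>(3), of f] by (auto simp: inj_on_def)
    then show ?thesis by simp
  qed
  moreover have "{\<sigma> - {a}, \<sigma> - {b}} \<subseteq> facets \<sigma>"
    using assms ab by (auto simp: facets_eq)
  ultimately have "(\<Sum>\<tau>\<in>facets \<sigma>. ?F \<tau>) = (\<Sum>\<tau>\<in>{\<sigma> - {a}, \<sigma> - {b}}. ?F \<tau>)"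
    using assms by (intro sum.mono_neutral_right) (auto simp: finite_facets)
  also have "\<dots> = ?F (\<sigma> - {a}) + ?F (\<sigma> - {b})"
    using ab by (subst sum.insert) auto
  also have "f ` (\<sigma> - {a}) = f ` (\<sigma> - {b})"
    using ab by (auto simp: image_iff) (metis insert_Diff insert_iff)+
  then have "?F (\<sigma> - {a}) + ?F (\<sigma> - {b}) = 0"
    using assms ab by simp
  finally show ?thesis using False by simp
qed

section \<open>Connectivity and spanning forests\<close>

lemma connected_by_edge: "(r, {a, b}) \<in> E \<Longrightarrow> (a, b) \<in> connected_by E"
  by (auto simp: connected_by_def)

lemma connected_by_refl [simp]: "(a, a) \<in> connected_by E"
  by (simp add: connected_by_def)

lemma connected_by_trans:
  "(a, b) \<in> connected_by E \<Longrightarrow> (b, c) \<in> connected_by E \<Longrightarrow> (a, c) \<in> connected_by E"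
  unfolding connected_by_def by (rule rtrancl_trans)

lemma connected_by_sym: "(a, b) \<in> connected_by E \<Longrightarrow> (b, a) \<in> connected_by E"
  unfolding connected_by_def
  by (rule symD[OF sym_rtrancl]) (auto simp: sym_def insert_commute)

lemma connected_by_mono: "E \<subseteq> E' \<Longrightarrow> connected_by E \<subseteq> connected_by E'"
  unfolding connected_by_def by (rule rtrancl_mono) auto

lemma connected_by_insert:
  assumes "(a, b) \<in> connected_by E"
  shows "connected_by (insert (r, {a, b}) E) = connected_by E"
proof
  have "{(c, d). \<exists>q. (q, {c, d}) \<in> insert (r, {a, b}) E} \<subseteq> connected_by E"
    using assms connected_by_sym[OF assms] by (auto simp: doubleton_eq_iff intro: connected_by_edge)
  then show "connected_by (insert (r, {a, b}) E) \<subseteq> connected_by E"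
    unfolding connected_by_def by (rule rtrancl_subset_rtrancl)
qed (auto intro: connected_by_mono[THEN subsetD])

text \<open>Without the new edge the cycle is a path in \<open>E\<close> between its ends: start at
  the far end of edge \<open>i\<close> and walk \<open>n - 1\<close> edges. The edges of a cycle are
  distinct, so none of these is the new one. Loops and pairs of parallel edges are covered
  too.\<close>

lemma creates_cycle_connected:
  assumes "creates_cycle E (r, e)"
  shows "\<exists>a b. e = {a, b} \<and> (a, b) \<in> connected_by E"
proof -
  obtain ns es where c: "cycle (insert (r, e) E) ns es" and "(r, e) \<in> set es"
    using assms by (auto simp: creates_cycle_def)
  then obtain i where i: "i < length es" "es ! i = (r, e)" by (auto simp: in_set_conv_nth)
  define n where "n = length es"
  have path: "(ns ! (Suc i mod n), ns ! ((Suc i + k) mod n)) \<in> connected_by E" if "k < n" for k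
    using that
  proof (induction k)
    case (Suc k)
    let ?j = "(Suc i + k) mod n"
    have j: "?j < n" using Suc.prems by simp
    \<comment> \<open>The walk returns to position \<open>i\<close> only after \<open>n - 1\<close>
      steps, and here \<open>k < n - 1\<close>.\<close>
    have "?j \<noteq> i"
    proof (cases "Suc i + k < n")
      case False
      then have "?j = Suc i + k - n" using Suc.prems i(1) by (simp add: n_def mod_if)
      with False Suc.prems show ?thesis by simp
    qed simp
    then have "es ! ?j \<noteq> (r, e)"
      using c i j nth_eq_iff_index_eq[of es ?j i] by (auto simp: cycle_def n_def)
    with c j have E: "es ! ?j \<in> E"
      unfolding cycle_def n_def by (meson insertE nth_mem subsetD)
    have "snd (es ! ?j) = {ns ! ?j, ns ! (Suc ?j mod n)}"
      using c j by (simp add: cycle_def n_def)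
    with E have "(ns ! ?j, ns ! (Suc ?j mod n)) \<in> connected_by E"
      by (intro connected_by_edge[of "fst (es ! ?j)"]) (metis prod.collapse)
    moreover have "Suc ?j mod n = (Suc i + Suc k) mod n"
      by (simp add: mod_Suc_eq)
    ultimately show ?case using Suc by (auto intro: connected_by_trans)
  qed simp
  have "Suc i + (n - 1) = i + n" using i(1) by (simp add: n_def)
  then have "(Suc i + (n - 1)) mod n = i" using i(1) by (simp add: n_def)
  then have "(ns ! (Suc i mod n), ns ! i) \<in> connected_by E"
    using path[of "n - 1"] i(1) unfolding n_def
    by (metis diff_less less_nat_zero_code not_gr_zero zero_less_one)
  moreover have "e = {ns ! i, ns ! (Suc i mod n)}"
    using c i by (auto simp: cycle_def n_def)
  ultimately show ?thesis using connected_by_sym by blast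
qed

text \<open>A minimal edge set with the connectivity of \<open>G\<close> has no cycle, since an edge
  on a cycle can be removed without disconnecting its ends.\<close>

lemma spanning_forest_exists:
  assumes "finite (edges G)"
  shows "\<exists>F. spanning_forest F G"
proof -
  let ?A = "{E. E \<subseteq> edges G \<and> connected_by E = connected_by (edges G)}"
  have "finite ?A" by (rule finite_subset[of _ "Pow (edges G)"]) (auto simp: assms)
  moreover have "edges G \<in> ?A" by simp
  ultimately obtain E where E: "E \<in> ?A" and min: "\<forall>E'\<in>?A. E' \<subseteq> E \<longrightarrow> E = E'"
    using finite_has_minimal[of ?A] by blast
  have "\<not> cycle E ns es" for ns es
  proof
    assume c: "cycle E ns es"
    then obtain r e where e: "(r, e) \<in> set es" "(r, e) \<in> E" by (cases es) (auto simp: cycle_def)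
    then have "insert (r, e) (E - {(r, e)}) = E" by auto
    with c e have "creates_cycle (E - {(r, e)}) (r, e)" unfolding creates_cycle_def by metis
    then obtain a b where "e = {a, b}" "(a, b) \<in> connected_by (E - {(r, e)})"
      using creates_cycle_connected by metis
    then have "connected_by (E - {(r, e)}) = connected_by E"
      using connected_by_insert[of a b "E - {(r, e)}" r] e(2) by (simp add: insert_absorb)
    with E have "E - {(r, e)} \<in> ?A" by auto
    with min have "E = E - {(r, e)}" by blast
    with e(2) show False by blast
  qed
  with E have "spanning_forest \<lparr>nodes = nodes G, edges = E\<rparr> G"
    by (auto simp: spanning_forest_def)
  then show ?thesis by blast
qed

section \<open>Classes of generators\<close>

text \<open>\<open>None\<close> stands for a degenerate simplex, in line with the node \<open>\<Omega>\<close>.\<close>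

definition push :: "('p, 'v) tower \<Rightarrow> 'p \<Rightarrow> 'p \<Rightarrow> 'v set option \<Rightarrow> 'v set option" where
  "push K x y c = Option.bind c
     (\<lambda>\<sigma>. if card (simp_map K x y \<sigma>) = card \<sigma> then Some (simp_map K x y \<sigma>) else None)"

definition cls :: "('p, 'v) tower \<Rightarrow> 'p \<Rightarrow> ('p, 'v) gen option \<Rightarrow> 'v set option" where
  "cls K x a = Option.bind a (\<lambda>g. push K (fst g) x (Some (snd g)))"

definition valid_nodes :: "('p::order, 'v) tower \<Rightarrow> 'p \<Rightarrow> ('p, 'v) gen option set" where
  "valid_nodes K x = insert None (Some ` {g \<in> gens K. fst g \<le> x})"

lemma cls_None [simp]: "cls K x None = None"
  by (simp add: cls_def)

lemma push_None [simp]: "push K x y None = None"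
  by (simp add: push_def)

lemma valid_nodes_mono: "x \<le> y \<Longrightarrow> valid_nodes K x \<subseteq> valid_nodes K y"
  by (auto simp: valid_nodes_def)

lemma None_valid [simp]: "None \<in> valid_nodes K x"
  by (simp add: valid_nodes_def)

lemma Some_valid: "Some g \<in> valid_nodes K x \<longleftrightarrow> g \<in> gens K \<and> fst g \<le> x"
  by (auto simp: valid_nodes_def)

locale tower_context =
  fixes K :: "('p::{finite,order}, 'v) tower"
  assumes tower: "poset_tower K"
begin

lemma finite_complex_cpx: "finite_complex (cpx K x)"
  and simplicial_map_vmap: "x \<le> y \<Longrightarrow> simplicial_map (cpx K x) (cpx K y) (vmap K x y)"
  and vmap_refl: "{v} \<in> cpx K x \<Longrightarrow> vmap K x x v = v"
  and vmap_comp: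
    "{v} \<in> cpx K x \<Longrightarrow> x \<le> y \<Longrightarrow> y \<le> z \<Longrightarrow> vmap K y z (vmap K x y v) = vmap K x z v"
proof -
  note t = tower[unfolded poset_tower_def]
  show "finite_complex (cpx K x)"
    using conjunct1[OF t] by (rule spec)
  show "x \<le> y \<Longrightarrow> simplicial_map (cpx K x) (cpx K y) (vmap K x y)"
    using conjunct1[OF conjunct2[OF t]] by simp
  show "{v} \<in> cpx K x \<Longrightarrow> vmap K x x v = v"
    using conjunct1[OF conjunct2[OF conjunct2[OF t]]] by simp
  show "{v} \<in> cpx K x \<Longrightarrow> x \<le> y \<Longrightarrow> y \<le> z \<Longrightarrow> vmap K y z (vmap K x y v) = vmap K x z v"
    using conjunct2[OF conjunct2[OF conjunct2[OF t]]] by simp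
qed

lemma finite_cpx: "finite (cpx K x)"
  using finite_complex_cpx[of x] unfolding finite_complex_def by blast

lemma cpxD:
  assumes "\<sigma> \<in> cpx K x"
  shows "finite \<sigma>" "\<sigma> \<noteq> {}"
  using finite_complex_cpx[of x] assms unfolding finite_complex_def by blast+

lemma cpx_face: "\<sigma> \<in> cpx K x \<Longrightarrow> \<tau> \<subseteq> \<sigma> \<Longrightarrow> \<tau> \<noteq> {} \<Longrightarrow> \<tau> \<in> cpx K x"
  using finite_complex_cpx[of x] unfolding finite_complex_def by blast

lemma cpx_facet: "\<sigma> \<in> cpx K x \<Longrightarrow> \<tau> \<in> facets \<sigma> \<Longrightarrow> \<tau> \<in> cpx K x"
  unfolding facets_def by (blast intro: cpx_face)

lemma cpx_vertex: "\<sigma> \<in> cpx K x \<Longrightarrow> v \<in> \<sigma> \<Longrightarrow> {v} \<in> cpx K x"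
  by (rule cpx_face) auto

lemma simp_map_cpx: "x \<le> y \<Longrightarrow> \<sigma> \<in> cpx K x \<Longrightarrow> simp_map K x y \<sigma> \<in> cpx K y"
  using simplicial_map_vmap[of x y] unfolding simplicial_map_def simp_map_def by simp

lemma simp_map_refl: "\<sigma> \<in> cpx K x \<Longrightarrow> simp_map K x x \<sigma> = \<sigma>"
  by (simp add: simp_map_def vmap_refl cpx_vertex)

lemma simp_map_comp:
  assumes "\<sigma> \<in> cpx K x" "x \<le> y" "y \<le> z"
  shows "simp_map K y z (simp_map K x y \<sigma>) = simp_map K x z \<sigma>"
  using vmap_comp[OF cpx_vertex[OF assms(1)] assms(2,3)] by (simp add: simp_map_def image_image)

lemma card_simp_map_le: "\<sigma> \<in> cpx K x \<Longrightarrow> card (simp_map K x y \<sigma>) \<le> card \<sigma>"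
  unfolding simp_map_def by (rule card_image_le) (rule cpxD)

text \<open>Cardinalities can only drop along the tower, so the composite preserves the dimension
  exactly when both maps do: a degenerate simplex never recovers.\<close>

lemma push_comp:
  assumes "\<sigma> \<in> cpx K x" "x \<le> y" "y \<le> z"
  shows "push K y z (push K x y (Some \<sigma>)) = push K x z (Some \<sigma>)"
  using simp_map_comp[OF assms] card_simp_map_le[OF assms(1), of y]
    card_simp_map_le[OF simp_map_cpx[OF assms(2,1)], of z]
  by (auto simp: push_def)

lemma push_refl: "\<sigma> \<in> cpx K x \<Longrightarrow> push K x x (Some \<sigma>) = Some \<sigma>"
  by (simp add: push_def simp_map_refl)

lemma push_Some_cpx: "push K x y (Some \<sigma>) = Some \<tau> \<Longrightarrow> \<sigma> \<in> cpx K x \<Longrightarrow> x \<le> y \<Longrightarrow> \<tau> \<in> cpx K y"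
  by (auto simp: push_def simp_map_cpx split: if_splits)

lemma push_Some_card: "push K x y (Some \<sigma>) = Some \<tau> \<Longrightarrow> card \<tau> = card \<sigma>"
  by (auto simp: push_def split: if_splits)

lemma push_Some_simplices:
  "push K x y (Some \<sigma>) = Some \<tau> \<Longrightarrow> \<sigma> \<in> simplices K l x \<Longrightarrow> x \<le> y \<Longrightarrow> \<tau> \<in> simplices K l y"
  using push_Some_cpx[of x y \<sigma> \<tau>] push_Some_card[of x y \<sigma> \<tau>]
  by (simp add: simplices_def simp_dim_def)

lemma gensD: "g \<in> gens K \<Longrightarrow> snd g \<in> cpx K (fst g)"
  by (auto simp: gens_def)

lemma finite_gens: "finite (gens K)"
proof (rule finite_subset)
  show "gens K \<subseteq> Sigma UNIV (cpx K)" by (auto simp: gens_def)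
qed (simp add: finite_cpx)

lemma gens_deg_subset: "gens_deg K l \<subseteq> gens K"
  by (auto simp: gens_deg_def)

lemma finite_gens_deg: "finite (gens_deg K l)"
  by (rule finite_subset[OF gens_deg_subset finite_gens])

lemma gens_deg_simplices: "g \<in> gens_deg K l \<Longrightarrow> snd g \<in> simplices K l (fst g)"
  by (auto simp: gens_deg_def simplices_def dest: gensD)

lemma cls_Some: "cls K x (Some g) = push K (fst g) x (Some (snd g))"
  by (simp add: cls_def)

lemma cls_self: "g \<in> gens K \<Longrightarrow> cls K (fst g) (Some g) = Some (snd g)"
  by (simp add: cls_Some push_refl gensD)

lemma cls_push: "a \<in> valid_nodes K x \<Longrightarrow> x \<le> y \<Longrightarrow> cls K y a = push K x y (cls K x a)"
  using push_comp[OF gensD] by (auto simp: valid_nodes_def cls_Some)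

lemma cls_eq_mono:
  assumes "cls K x a = cls K x b" "a \<in> valid_nodes K x" "b \<in> valid_nodes K x" "x \<le> y"
  shows "cls K y a = cls K y b"
  using assms by (metis cls_push)

lemma cls_Some_cpx:
  "g \<in> gens K \<Longrightarrow> fst g \<le> x \<Longrightarrow> cls K x (Some g) = Some \<tau> \<Longrightarrow> \<tau> \<in> cpx K x"
  by (auto simp: cls_Some dest: gensD push_Some_cpx)

lemma cls_Some_dim: "cls K x (Some g) = Some \<tau> \<Longrightarrow> simp_dim \<tau> = simp_dim (snd g)"
  by (auto simp: cls_Some simp_dim_def dest: push_Some_card)

lemma cls_Some_simplices:
  "g \<in> gens_deg K l \<Longrightarrow> fst g \<le> x \<Longrightarrow> cls K x (Some g) = Some \<tau> \<Longrightarrow> \<tau> \<in> simplices K l x"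
  using push_Some_simplices gens_deg_simplices by (simp add: cls_Some)

text \<open>A simplex that is not a generator comes from a covered grade, which has fewer grades
  below it; the class found there is pushed up.\<close>

lemma generator_of_simplex:
  "\<tau> \<in> cpx K x \<Longrightarrow> \<exists>g\<in>gens K. fst g \<le> x \<and> cls K x (Some g) = Some \<tau>"
proof (induction "card {z. z < x}" arbitrary: x \<tau> rule: less_induct)
  case less
  show ?case
  proof (cases "(x, \<tau>) \<in> gens K")
    case True
    then show ?thesis using cls_self[of "(x, \<tau>)"] by (intro bexI[of _ "(x, \<tau>)"]) auto
  next
    case False
    then obtain y \<rho> where y: "y \<prec> x" and \<rho>: "\<rho> \<in> cpx K y" "\<tau> = vmap K y x ` \<rho>"
      using less.prems by (auto simp: gens_def simp_map_def)
    \<comment> \<open>The preimage may have higher dimension than \<tau> and would then have class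
      \<open>None\<close> at \<open>x\<close>. A face with exactly one vertex over each vertex of
      \<tau> avoids this.\<close>
    obtain \<rho>' where \<rho>': "\<rho>' \<subseteq> \<rho>" "inj_on (vmap K y x) \<rho>'" "vmap K y x ` \<rho>' = \<tau>"
      using \<rho>(2) subset_image_inj[of \<tau> "vmap K y x" \<rho>] by auto
    then have c: "\<rho>' \<in> cpx K y" using \<rho> cpxD[OF less.prems] by (intro cpx_face[OF \<rho>(1)]) auto
    have yx: "y < x" "y \<le> x" using y by (auto simp: covers_def)
    then have "card {z. z < y} < card {z. z < x}" by (intro psubset_card_mono) auto
    from less.hyps[OF this c] obtain g where
      g: "g \<in> gens K" "fst g \<le> y" "cls K y (Some g) = Some \<rho>'" by blast
    have "cls K x (Some g) = push K y x (Some \<rho>')"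
      using g yx cls_push[of "Some g" y x] by (simp add: Some_valid)
    also have "\<dots> = Some \<tau>" using \<rho>' by (auto simp: push_def simp_map_def card_image)
    finally show ?thesis using g yx by force
  qed
qed

section \<open>The modules\<close>

abbreviation gens_upto :: "int \<Rightarrow> 'p \<Rightarrow> ('p, 'v) gen set" where
  "gens_upto l x \<equiv> {g \<in> gens_deg K l. fst g \<le> x}"

lemma finite_simplices: "finite (simplices K l x)"
  using finite_cpx by (auto simp: simplices_def)

lemma spc_gen_module: "spc (gen_module K l) x = free_space (gens_upto l x)"
  by (simp add: gen_module_def spc_proj_sum)

lemma spc_chain_module: "spc (chain_module K l) x = free_space (simplices K l x)"
  by (simp add: chain_module_def)

text \<open>The image is always a simplex of the complex at \<open>y\<close>, so testing its
  dimension is the same as testing that no vertices are identified.\<close>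

lemma chain_map_basis_apply:
  assumes "\<sigma> \<in> simplices K l x" "x \<le> y"
  shows "chain_map_basis K l x y \<sigma> \<tau> = of_bool (push K x y (Some \<sigma>) = Some \<tau>)"
proof -
  have "simp_map K x y \<sigma> \<in> simplices K l y \<longleftrightarrow> card (simp_map K x y \<sigma>) = card \<sigma>"
    using assms simp_map_cpx[OF assms(2)] by (auto simp: simplices_def simp_dim_def)
  then show ?thesis
    by (auto simp: chain_map_basis_def push_def basis_vec_def)
qed

lemma trn_chain_module:
  assumes "x \<le> y"
  shows "trn (chain_module K l) x y v \<tau> =
    (\<Sum>\<sigma>\<in>simplices K l x. v \<sigma> * of_bool (push K x y (Some \<sigma>) = Some \<tau>))"
  using assms by (simp add: chain_module_def lin_ext_apply chain_map_basis_apply)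

lemma gen_map_apply:
  "gen_map K l x v \<tau> = (\<Sum>g\<in>gens_upto l x. v g * of_bool (cls K x (Some g) = Some \<tau>))"
  by (auto simp: gen_map_def lin_ext_apply cls_Some chain_map_basis_apply case_prod_unfold
      dest: gens_deg_simplices intro!: sum.cong)

lemma boundary_apply:
  "boundary K l x v \<tau> = (\<Sum>\<sigma>\<in>simplices K l x. v \<sigma> * of_bool (\<tau> \<in> facets \<sigma>))"
proof -
  have "(\<Sum>\<rho>\<in>facets \<sigma>. basis_vec \<rho>) \<tau> = (of_bool (\<tau> \<in> facets \<sigma>) :: bit)"
    if "\<sigma> \<in> simplices K l x" for \<sigma>
    using that cpxD(1)[of \<sigma> x] finite_facets[of \<sigma>]
    by (simp add: sum_fun_apply basis_vec_def simplices_def)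
  then show ?thesis by (simp add: boundary_def lin_ext_apply)
qed

lemma trn_chain_module_comp:
  assumes "x \<le> y" "y \<le> z"
  shows "trn (chain_module K l) y z (trn (chain_module K l) x y v) = trn (chain_module K l) x z v"
proof
  fix \<rho>
  have xz: "x \<le> z" using assms by simp
  have "trn (chain_module K l) y z (trn (chain_module K l) x y v) \<rho> =
      (\<Sum>\<sigma>\<in>simplices K l x. v \<sigma> * (case push K x y (Some \<sigma>) of None \<Rightarrow> 0 | Some \<tau> \<Rightarrow>
        of_bool (push K y z (Some \<tau>) = Some \<rho>)))"
    unfolding trn_chain_module[OF assms(1)] trn_chain_module[OF assms(2)]
    using push_Some_simplices[OF _ _ assms(1)]
    by (intro sum_by_class finite_simplices) (auto simp: not_None_eq intro: option.exhaust)
  also have "\<dots> = (\<Sum>\<sigma>\<in>simplices K l x. v \<sigma> * of_bool (push K x z (Some \<sigma>) = Some \<rho>))"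
  proof (intro sum.cong arg_cong2[where f = times] refl)
    fix \<sigma> assume "\<sigma> \<in> simplices K l x"
    then have "\<sigma> \<in> cpx K x" by (simp add: simplices_def)
    then show "(case push K x y (Some \<sigma>) of None \<Rightarrow> 0 | Some \<tau> \<Rightarrow>
        of_bool (push K y z (Some \<tau>) = Some \<rho>)) = (of_bool (push K x z (Some \<sigma>) = Some \<rho>) :: bit)"
      using push_comp[of \<sigma> x y z] assms by (auto split: option.split)
  qed
  finally show "trn (chain_module K l) y z (trn (chain_module K l) x y v) \<rho> =
      trn (chain_module K l) x z v \<rho>"
    by (simp add: trn_chain_module[OF xz])
qed

lemma persistence_module_chain_module: "persistence_module (chain_module K l)"
proof -
  let ?M = "chain_module K l"
  have sub: "F2.subspace (spc ?M x)" for x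
    by (simp add: spc_chain_module subspace_free_space)
  have fin: "\<exists>B. finite B \<and> F2.span B = spc ?M x" for x
    using free_space_span[OF finite_simplices, of l x] finite_simplices[of l x]
    by (intro exI[of _ "basis_vec ` simplices K l x"]) (simp add: spc_chain_module)
  have lin: "linear_on (spc ?M x) (trn ?M x y)" if "x \<le> y" for x y
    by (rule linear_onI_sum[OF trn_chain_module[OF that] sub])
  have maps: "trn ?M x y ` spc ?M x \<subseteq> spc ?M y" if "x \<le> y" for x y
  proof -
    have "trn ?M x y v \<tau> = 0" if "\<tau> \<notin> simplices K l y" for v \<tau>
      unfolding trn_chain_module[OF \<open>x \<le> y\<close>]
      using that push_Some_simplices[OF _ _ \<open>x \<le> y\<close>] by (intro sum.neutral) auto
    then show ?thesis by (auto simp: spc_chain_module free_space_def)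
  qed
  have refl: "trn ?M x x v = v" if "v \<in> spc ?M x" for x v
  proof
    fix \<tau>
    have "trn ?M x x v \<tau> = (\<Sum>\<sigma>\<in>simplices K l x. if \<sigma> = \<tau> then v \<tau> else 0)"
      unfolding trn_chain_module[OF order_refl]
      by (intro sum.cong) (auto simp: push_refl simplices_def)
    then show "trn ?M x x v \<tau> = v \<tau>"
      using that by (simp add: finite_simplices spc_chain_module free_space_def)
  qed
  show ?thesis
    unfolding persistence_module_def
    by (intro conjI allI impI ballI sub fin lin maps refl trn_chain_module_comp) simp_all
qed

lemma linear_on_gen_map: "linear_on (spc (gen_module K l) x) (gen_map K l x)"
  by (rule linear_onI_sum[OF gen_map_apply]) (simp add: spc_gen_module subspace_free_space)

lemma gen_map_natural:
  assumes v: "v \<in> spc (gen_module K l) x" and xy: "x \<le> y"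
  shows "gen_map K l y v = trn (chain_module K l) x y (gen_map K l x v)"
proof
  fix \<rho>
  have "trn (chain_module K l) x y (gen_map K l x v) \<rho> =
      (\<Sum>g\<in>gens_upto l x. v g * (case cls K x (Some g) of None \<Rightarrow> 0 | Some \<tau> \<Rightarrow>
        of_bool (push K x y (Some \<tau>) = Some \<rho>)))"
    unfolding trn_chain_module[OF xy] gen_map_apply
    using cls_Some_simplices by (intro sum_by_class finite_simplices) (auto intro: option.exhaust)
  also have "\<dots> = (\<Sum>g\<in>gens_upto l x. v g * of_bool (cls K y (Some g) = Some \<rho>))"
  proof (intro sum.cong arg_cong2[where f = times] refl)
    fix g assume "g \<in> gens_upto l x"
    then have "cls K y (Some g) = push K x y (cls K x (Some g))"
      using gens_deg_subset xy by (intro cls_push) (auto simp: Some_valid)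
    then show "(case cls K x (Some g) of None \<Rightarrow> 0 | Some \<tau> \<Rightarrow>
        of_bool (push K x y (Some \<tau>) = Some \<rho>)) = (of_bool (cls K y (Some g) = Some \<rho>) :: bit)"
      by (auto split: option.split)
  qed
  \<comment> \<open>The generators added to the sum are not born below \<open>x\<close>, where
    \<open>v\<close> has coefficient 0.\<close>
  also have "\<dots> = (\<Sum>g\<in>gens_upto l y. v g * of_bool (cls K y (Some g) = Some \<rho>))"
    using v xy by (intro sum.mono_neutral_left)
      (auto simp: finite_gens_deg spc_gen_module free_space_def dest: order_trans)
  finally show "gen_map K l y v \<rho> = trn (chain_module K l) x y (gen_map K l x v) \<rho>"
    by (simp add: gen_map_apply)
qed

lemma morphism_gen_map: "morphism (gen_module K l) (chain_module K l) (gen_map K l)"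
proof -
  have maps: "gen_map K l x v \<in> spc (chain_module K l) x" for x v
  proof -
    have "gen_map K l x v \<tau> = 0" if "\<tau> \<notin> simplices K l x" for \<tau>
      unfolding gen_map_apply using that cls_Some_simplices by (intro sum.neutral) auto
    then show ?thesis by (auto simp: spc_chain_module free_space_def)
  qed
  have mod: "persistence_module (gen_module K l)"
    by (simp add: gen_module_def persistence_module_proj_sum finite_gens_deg)
  have "trn (gen_module K l) x y v = v"
    if "x \<le> y" "v \<in> spc (gen_module K l) x" for x y v
    using that by (simp add: gen_module_def trn_proj_sum)
  then show ?thesis
    unfolding morphism_def
    by (intro conjI allI impI ballI mod persistence_module_chain_module linear_on_gen_map)
      (use maps in blast, metis gen_map_natural)
qed

text \<open>The image is a subspace, so it is enough to reach each basis vector. A generator with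
  class \<tau> does this; it lies in degree \<open>l\<close> because a class has the dimension of
  its generator.\<close>

lemma gen_map_surj: "gen_map K l x ` spc (gen_module K l) x = spc (chain_module K l) x"
proof
  show "gen_map K l x ` spc (gen_module K l) x \<subseteq> spc (chain_module K l) x"
    using morphism_gen_map by (auto simp: morphism_def)
next
  let ?Im = "gen_map K l x ` spc (gen_module K l) x"
  have "basis_vec \<tau> \<in> ?Im" if \<tau>: "\<tau> \<in> simplices K l x" for \<tau>
  proof -
    obtain g where g: "g \<in> gens K" "fst g \<le> x" "cls K x (Some g) = Some \<tau>"
      using generator_of_simplex[of \<tau> x] \<tau> by (auto simp: simplices_def)
    then have gd: "g \<in> gens_upto l x"
      using \<tau> cls_Some_dim[OF g(3)] by (auto simp: gens_deg_def simplices_def)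
    have "gen_map K l x (basis_vec g) = basis_vec \<tau>"
    proof
      fix \<rho>
      have "gen_map K l x (basis_vec g) \<rho> =
          (\<Sum>h\<in>gens_upto l x. if h = g then of_bool (\<tau> = \<rho>) else 0)"
        unfolding gen_map_apply by (rule sum.cong) (auto simp: basis_vec_def g(3))
      also have "\<dots> = basis_vec \<tau> \<rho>"
        using gd by (auto simp: finite_gens_deg basis_vec_def)
      finally show "gen_map K l x (basis_vec g) \<rho> = basis_vec \<tau> \<rho>" .
    qed
    moreover have "basis_vec g \<in> spc (gen_module K l) x"
      using gd by (auto simp: spc_gen_module free_space_def basis_vec_def)
    ultimately show ?thesis by (metis imageI)
  qed
  then have "F2.span (basis_vec ` simplices K l x) \<subseteq> ?Im"
    by (intro F2.span_minimal subspace_linear_image linear_on_gen_map)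
      (auto simp: spc_gen_module subspace_free_space)
  then show "spc (chain_module K l) x \<subseteq> ?Im"
    by (simp add: free_space_span finite_simplices spc_chain_module)
qed

section \<open>Presentations and lifts given by matrices\<close>

text \<open>The ends must differ so that the indicator of the edge equals the sum of the unit
  vectors of its ends; for a loop that sum would be 0. \<Omega> has no row, so an edge at \<Omega>
  gives a column with a single entry.\<close>

definition column_joins :: "('p, 'v) pirep_state \<Rightarrow> 'p rel_id \<times> ('p, 'v) gen option set \<Rightarrow> bool" where
  "column_joins s = (\<lambda>(r, e). r \<in> rels s \<and> (\<exists>a b. a \<noteq> b \<and> e = {a, b}) \<and>
     (\<forall>g. p1 s g r = of_bool (Some g \<in> e)))"

definition sound_relations :: "('p, 'v) pirep_state \<Rightarrow> bool" where
  "sound_relations s \<longleftrightarrow> finite (rels s) \<and> (\<forall>r\<in>rels s. \<exists>a b. a \<in> valid_nodes K (fst r) \<and>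
     b \<in> valid_nodes K (fst r) \<and> cls K (fst r) a = cls K (fst r) b \<and> column_joins s (r, {a, b}))"

text \<open>Connectivity is stated through one representative per class, with \<Omega> representing
  the degenerate ones, because the kernel argument substitutes representatives. The edge set is
  existential, which keeps the forests of the algorithm out of the linear algebra.\<close>

definition complete_relations :: "('p, 'v) pirep_state \<Rightarrow> 'p \<Rightarrow> bool" where
  "complete_relations s x \<longleftrightarrow> (\<exists>E \<rho>. (\<forall>(r, e)\<in>E. fst r \<le> x \<and> column_joins s (r, e)) \<and>
     (\<forall>g\<in>gens K. fst g \<le> x \<longrightarrow>
        (Some g, map_option \<rho> (cls K x (Some g))) \<in> connected_by E))"

text \<open>The nodes \<open>h \<tau>\<close> are described by their classes and not as entries of
  the list: merging may delete such an entry later, but the class remains.\<close>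

definition boundary_column :: "('p, 'v) pirep_state \<Rightarrow> ('p, 'v) gen \<Rightarrow> bool" where
  "boundary_column s c \<longleftrightarrow> (\<exists>h.
     (\<forall>\<tau>\<in>facets (snd c). Some (h \<tau>) \<in> valid_nodes K (fst c) \<and>
        cls K (fst c) (Some (h \<tau>)) = Some \<tau>) \<and>
     (\<forall>g. f0 s g c = of_bool (g \<in> h ` facets (snd c))))"

lemma column_joins_entry:
  assumes "column_joins s (r, {a, b})"
  shows "p1 s g r = of_bool (a = Some g) + of_bool (b = Some g)"
proof -
  obtain c d where "c \<noteq> d" "{a, b} = {c, d}" using assms unfolding column_joins_def by blast
  then have "a \<noteq> b" by (metis doubleton_eq_iff)
  moreover have "p1 s g r = of_bool (Some g \<in> {a, b})" using assms unfolding column_joins_def case_prod_conv by blast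
  ultimately show ?thesis by auto
qed

text \<open>The right side depends on \<open>a\<close> only through its class, so the contributions
  of the two ends of a column cancel modulo 2.\<close>

lemma sum_class_at_node:
  assumes "a \<in> valid_nodes K x"
  shows "(\<Sum>g\<in>gens_upto l x. of_bool (a = Some g) * of_bool (cls K x (Some g) = Some \<tau>)) =
    (of_bool (cls K x a = Some \<tau> \<and> simp_dim \<tau> = l) :: bit)"
proof (cases a)
  case (Some h)
  then have h: "h \<in> gens K" "fst h \<le> x" using assms by (auto simp: Some_valid)
  have "(\<Sum>g\<in>gens_upto l x. of_bool (a = Some g) * of_bool (cls K x (Some g) = Some \<tau>)) =
      (\<Sum>g\<in>gens_upto l x. if g = h then of_bool (cls K x (Some h) = Some \<tau>) else (0::bit))"
    by (rule sum.cong) (auto simp: Some)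
  also have "\<dots> = (if h \<in> gens_upto l x then of_bool (cls K x (Some h) = Some \<tau>) else 0)"
    by (simp add: finite_gens_deg)
  also have "\<dots> = of_bool (simp_dim (snd h) = l \<and> cls K x (Some h) = Some \<tau>)"
    using h by (auto simp: gens_deg_def case_prod_unfold)
  also have "(simp_dim (snd h) = l \<and> cls K x (Some h) = Some \<tau>) \<longleftrightarrow>
      (cls K x a = Some \<tau> \<and> simp_dim \<tau> = l)"
    using cls_Some_dim[of x h \<tau>] Some by auto
  finally show ?thesis .
qed simp

lemma finite_rels_deg: "sound_relations s \<Longrightarrow> finite (rels_deg K s l)"
  by (auto simp: sound_relations_def rels_deg_def)

lemma spc_rel_module:
  "spc (rel_module K s l) x = free_space {r \<in> rels_deg K s l. fst r \<le> x}"
  by (simp add: rel_module_def spc_proj_sum)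

lemma morphism_p1_map:
  assumes "sound_relations s"
  shows "morphism (rel_module K s l) (gen_module K l) (p1_map K s l)"
proof -
  have "fst g \<le> fst r" if r: "r \<in> rels_deg K s l" and "p1 s g r \<noteq> 0" for r g
  proof -
    obtain a b where "a \<in> valid_nodes K (fst r)" "b \<in> valid_nodes K (fst r)"
      "column_joins s (r, {a, b})"
      using assms r by (force simp: sound_relations_def rels_deg_def)
    then show ?thesis
      using that(2) by (auto simp: column_joins_entry Some_valid of_bool_def split: if_splits)
  qed
  then show ?thesis
    unfolding rel_module_def gen_module_def p1_map_def
    by (intro morphism_mat_map finite_rels_deg assms finite_gens_deg)
qed

lemma gen_map_p1_map:
  assumes s: "sound_relations s" and v: "v \<in> spc (rel_module K s l) x"
  shows "gen_map K l x (p1_map K s l x v) = 0"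
proof
  fix \<tau>
  have "(\<Sum>g\<in>gens_upto l x. p1 s g r * of_bool (cls K x (Some g) = Some \<tau>)) = 0"
    if r: "r \<in> rels_deg K s l" "fst r \<le> x" for r
  proof -
    obtain a b where ab: "a \<in> valid_nodes K (fst r)" "b \<in> valid_nodes K (fst r)"
      "cls K (fst r) a = cls K (fst r) b" "column_joins s (r, {a, b})"
      using s r by (force simp: sound_relations_def rels_deg_def)
    note p = column_joins_entry[OF ab(4)]
    have "a \<in> valid_nodes K x" "b \<in> valid_nodes K x" "cls K x a = cls K x b"
      using ab r(2) valid_nodes_mono cls_eq_mono by blast+
    then show ?thesis
      by (simp add: p distrib_right sum.distrib sum_class_at_node)
  qed
  moreover have "v r = 0" if "r \<in> rels_deg K s l" "\<not> fst r \<le> x" for r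
    using free_spaceD[OF v[unfolded spc_rel_module]] that by blast
  ultimately have "(\<Sum>r\<in>rels_deg K s l. v r *
      (\<Sum>g\<in>gens_upto l x. p1 s g r * of_bool (cls K x (Some g) = Some \<tau>))) = 0"
    by (intro sum.neutral ballI) (simp, blast)
  moreover have "gen_map K l x (p1_map K s l x v) \<tau> = (\<Sum>g\<in>gens_upto l x.
      \<Sum>r\<in>rels_deg K s l. v r * (p1 s g r * of_bool (cls K x (Some g) = Some \<tau>)))"
    unfolding gen_map_apply p1_map_def
    by (intro sum.cong refl) (simp add: mat_map_apply sum_distrib_right mult.assoc)
  ultimately show "gen_map K l x (p1_map K s l x v) \<tau> = 0 \<tau>"
    by (subst (asm) sum_distrib_left, subst (asm) sum.swap) simp
qed

text \<open>Modulo the image of \<open>p1\<close>, generators in the same component of the graph agree and those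
  connected to \<open>\<Omega>\<close> vanish. Replacing every generator by the representative of its class turns a
  vector into one whose coefficients are those of its image under \<open>gen_map\<close>.\<close>

lemma kernel_subset_image:
  assumes s: "sound_relations s" and c: "complete_relations s x"
    and v: "v \<in> spc (gen_module K l) x" "gen_map K l x v = 0"
  shows "v \<in> p1_map K s l x ` spc (rel_module K s l) x"
proof -
  define Im where "Im = p1_map K s l x ` spc (rel_module K s l) x"
  have sub: "F2.subspace Im"
    unfolding Im_def using morphism_p1_map[OF s]
    by (intro subspace_linear_image) (auto simp: spc_rel_module subspace_free_space morphism_def)
  \<comment> \<open>Unit vectors cut down to degree \<open>l\<close>: \<Omega> and generators of
    other degrees go to 0, so that paths through them can still be summed.\<close>
  define e :: "('p, 'v) gen option \<Rightarrow> ('p, 'v) gen \<Rightarrow> bit"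
    where "e a g = of_bool (g \<in> gens_deg K l \<and> a = Some g)" for a g
  obtain E \<rho> where E: "\<And>r d. (r, d) \<in> E \<Longrightarrow> fst r \<le> x \<and> column_joins s (r, d)"
    and \<rho>: "\<And>g. g \<in> gens K \<Longrightarrow> fst g \<le> x \<Longrightarrow> (Some g, map_option \<rho> (cls K x (Some g))) \<in> connected_by E"
    using c unfolding complete_relations_def by blast
  have edge: "e a + e b \<in> Im" if r: "(r, {a, b}) \<in> E" for r a b
  proof -
    have col: "column_joins s (r, {a, b})" and rx: "fst r \<le> x" using E r by auto
    note p = column_joins_entry[OF col]
    show ?thesis
    proof (cases "r \<in> rels_deg K s l")
      case True
      have "p1_map K s l x (basis_vec r) = e a + e b"
      proof
        fix g
        have "(\<Sum>r'\<in>rels_deg K s l. basis_vec r r' * p1 s g r') =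
            (\<Sum>r'\<in>rels_deg K s l. if r' = r then p1 s g r else 0)"
          by (rule sum.cong) (auto simp: basis_vec_def)
        also have "\<dots> = p1 s g r" using True finite_rels_deg[OF s] by simp
        finally have "p1_map K s l x (basis_vec r) g = (if g \<in> gens_deg K l then p1 s g r else 0)"
          by (simp add: p1_map_def mat_map_apply) (simp add: mat_map_def)
        then show "p1_map K s l x (basis_vec r) g = (e a + e b) g"
          by (simp add: p e_def)
      qed
      moreover have "basis_vec r \<in> spc (rel_module K s l) x"
        using True rx by (auto simp: spc_rel_module free_space_def basis_vec_def)
      ultimately show ?thesis unfolding Im_def by (metis imageI)
    next
      case False
      \<comment> \<open>A column outside degree \<open>l\<close> has no entry in a row of that
        degree, so \<open>e a + e b\<close> vanishes.\<close>
      then have "p1 s g r = 0" if "g \<in> gens_deg K l" for g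
        using col that by (auto simp: rels_deg_def column_joins_def)
      then have "(e a + e b) g = 0" for g
        using p[of g] by (cases "g \<in> gens_deg K l") (simp_all add: e_def)
      then have "e a + e b = 0" by (simp only: fun_eq_iff zero_fun_apply) blast
      then show ?thesis using F2.subspace_0[OF sub] by simp
    qed
  qed
  have path: "e a + e b \<in> Im" if "(a, b) \<in> connected_by E" for a b
    using that unfolding connected_by_def
  proof (induction rule: rtrancl_induct)
    case base
    have "e a + e a = 0" by (simp add: fun_eq_iff)
    then show ?case using F2.subspace_0[OF sub] by (simp only:)
  next
    case (step b c)
    then obtain r where "(r, {b, c}) \<in> E" by blast
    then have "(e a + e b) + (e b + e c) \<in> Im" by (rule F2.subspace_add[OF sub step.IH edge])
    \<comment> \<open>Telescoping along the path: the middle node occurs twice and cancels.\<close>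
    moreover have "(e a + e b) + (e b + e c) = e a + e c"
    proof
      fix g
      have "e b g + (e b g + e c g) = e c g" by (simp flip: add.assoc)
      then show "((e a + e b) + (e b + e c)) g = (e a + e c) g" by (simp add: add.assoc)
    qed
    ultimately show ?case by (simp only:)
  qed
  let ?r = "\<lambda>g. e (map_option \<rho> (cls K x (Some g)))"
  \<comment> \<open>Adding the representatives changes nothing: grouped by class, their total has
    the coefficients of \<open>gen_map K l x v\<close>, which is 0.\<close>
  have "v = (\<Sum>g\<in>gens_upto l x. vscale (v g) (e (Some g) + ?r g))"
  proof
    fix h
    have "(\<Sum>g\<in>gens_upto l x. v g * e (Some g) h) = (\<Sum>g\<in>gens_upto l x. if g = h then v h else 0)"
      by (rule sum.cong) (auto simp: e_def)
    also have "\<dots> = v h"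
      using free_spaceD[OF v(1)[unfolded spc_gen_module], of h] by (auto simp: finite_gens_deg)
    finally have 1: "(\<Sum>g\<in>gens_upto l x. v g * e (Some g) h) = v h" .
    have "(\<Sum>g\<in>gens_upto l x. v g * ?r g h) =
        (\<Sum>g\<in>gens_upto l x. v g * (case cls K x (Some g) of None \<Rightarrow> 0 | Some \<tau> \<Rightarrow> e (Some (\<rho> \<tau>)) h))"
      by (intro sum.cong) (auto simp: e_def split: option.split)
    also have "\<dots> = (\<Sum>\<tau>\<in>simplices K l x. gen_map K l x v \<tau> * e (Some (\<rho> \<tau>)) h)"
      unfolding gen_map_apply using cls_Some_simplices
      by (intro sum_by_class[symmetric] finite_simplices) (auto intro: option.exhaust)
    also have "\<dots> = 0" using v(2) by simp
    finally show "v h = (\<Sum>g\<in>gens_upto l x. vscale (v g) (e (Some g) + ?r g)) h"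
      by (simp add: sum_fun_apply vscale_apply distrib_left sum.distrib 1)
  qed
  also have "\<dots> \<in> Im"
    using \<rho> gens_deg_subset by (intro F2.subspace_sum[OF sub] F2.subspace_scale[OF sub] path) auto
  finally show ?thesis by (simp add: Im_def)
qed

lemma exact_presentation_relations:
  assumes "sound_relations s" and "\<And>x. complete_relations s x"
  shows "exact_presentation (chain_module K l) (gen_map K l) (gen_module K l)
    (p1_map K s l) (rel_module K s l)"
proof -
  have "p1_map K s l x ` spc (rel_module K s l) x \<subseteq> spc (gen_module K l) x" for x
    using morphism_p1_map[OF assms(1)] by (auto simp: morphism_def)
  moreover have "{v \<in> spc (gen_module K l) x. gen_map K l x v = 0} \<subseteq>
      p1_map K s l x ` spc (rel_module K s l) x" for x
    using kernel_subset_image[OF assms] by auto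
  ultimately have "p1_map K s l x ` spc (rel_module K s l) x =
      {v \<in> spc (gen_module K l) x. gen_map K l x v = 0}" for x
    using gen_map_p1_map[OF assms(1), of _ l x] by (intro subset_antisym) auto
  then show ?thesis
    unfolding exact_presentation_def
    by (intro conjI allI morphism_gen_map morphism_p1_map[OF assms(1)] gen_map_surj)
qed

section \<open>The lift of the boundary\<close>

lemma boundary_column_row:
  assumes c: "c \<in> gens_deg K l" "boundary_column s c" and "f0 s g c \<noteq> 0"
  shows "g \<in> gens_deg K (l - 1) \<and> fst g \<le> fst c"
proof -
  obtain h where h: "\<And>\<tau>. \<tau> \<in> facets (snd c) \<Longrightarrow> Some (h \<tau>) \<in> valid_nodes K (fst c) \<and>
        cls K (fst c) (Some (h \<tau>)) = Some \<tau>"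
    and "\<And>g. f0 s g c = of_bool (g \<in> h ` facets (snd c))"
    using c(2) unfolding boundary_column_def by blast
  with assms(3) obtain \<tau> where "\<tau> \<in> facets (snd c)" "g = h \<tau>" by auto
  with h have \<tau>: "\<tau> \<in> facets (snd c)" "Some g \<in> valid_nodes K (fst c)"
    "cls K (fst c) (Some g) = Some \<tau>" by auto
  then show ?thesis
    using cls_Some_dim[OF \<tau>(3)] c(1)
    by (auto simp: Some_valid gens_deg_def facets_def case_prod_unfold)
qed

lemma morphism_f0_map:
  assumes "\<And>c. c \<in> gens K \<Longrightarrow> boundary_column s c"
  shows "morphism (gen_module K l) (gen_module K (l - 1)) (f0_map K s l)"
  unfolding gen_module_def f0_map_def
  using assms boundary_column_row gens_deg_subset
  by (intro morphism_mat_map finite_gens_deg) blast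

text \<open>At grade \<open>x\<close> the nodes of the column become the images of the facets, with
  degenerate ones counted as 0. By parity these add up to the boundary of the image simplex, or to 0
  if that simplex is degenerate.\<close>

lemma boundary_column_sum:
  assumes c: "c \<in> gens_deg K l" "boundary_column s c" and x: "fst c \<le> x"
  shows "(\<Sum>g\<in>gens_upto (l - 1) x. f0 s g c * of_bool (cls K x (Some g) = Some \<tau>)) =
    (case cls K x (Some c) of None \<Rightarrow> 0 | Some \<sigma> \<Rightarrow> of_bool (\<tau> \<in> facets \<sigma>))"
proof -
  let ?y = "fst c" and ?\<sigma> = "snd c"
  obtain h where h: "\<And>\<rho>. \<rho> \<in> facets ?\<sigma> \<Longrightarrow> Some (h \<rho>) \<in> valid_nodes K ?y"
      "\<And>\<rho>. \<rho> \<in> facets ?\<sigma> \<Longrightarrow> cls K ?y (Some (h \<rho>)) = Some \<rho>"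
    and f0: "\<And>g. f0 s g c = of_bool (g \<in> h ` facets ?\<sigma>)"
    using c(2) by (auto simp: boundary_column_def)
  have \<sigma>: "finite ?\<sigma>" "?\<sigma> \<noteq> {}"
    using c(1) gens_deg_subset gensD cpxD by blast+
  \<comment> \<open>The facet can be read off as the class of its node. Hence the 0/1 column, which
    records only the set of nodes, loses no multiplicity.\<close>
  have inj: "inj_on h (facets ?\<sigma>)"
    using h(2) by (metis inj_onI option.inject)
  have sub: "h ` facets ?\<sigma> \<subseteq> gens_upto (l - 1) x"
  proof
    fix g assume "g \<in> h ` facets ?\<sigma>"
    then have "f0 s g c \<noteq> 0" by (simp add: f0)
    then show "g \<in> gens_upto (l - 1) x"
      using boundary_column_row[OF c, of g] x by auto
  qed
  have "(\<Sum>g\<in>gens_upto (l - 1) x. f0 s g c * of_bool (cls K x (Some g) = Some \<tau>)) =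
      (\<Sum>g\<in>h ` facets ?\<sigma>. of_bool (cls K x (Some g) = Some \<tau>))"
    using sub by (intro sum.mono_neutral_cong_right) (auto simp: finite_gens_deg f0)
  also have "\<dots> = (\<Sum>\<rho>\<in>facets ?\<sigma>. of_bool (cls K x (Some (h \<rho>)) = Some \<tau>))"
    by (simp add: sum.reindex[OF inj])
  also have "\<dots> = (\<Sum>\<rho>\<in>facets ?\<sigma>. of_bool (card (vmap K ?y x ` \<rho>) = card \<rho> \<and> vmap K ?y x ` \<rho> = \<tau>))"
    using h cls_push[OF h(1) x]
    by (intro sum.cong refl) (auto simp: push_def simp_map_def)
  also have "\<dots> = of_bool (card (vmap K ?y x ` ?\<sigma>) = card ?\<sigma> \<and> \<tau> \<in> facets (vmap K ?y x ` ?\<sigma>))"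
    by (rule facets_image_parity[OF \<sigma>])
  also have "\<dots> = (case cls K x (Some c) of None \<Rightarrow> 0 | Some \<sigma> \<Rightarrow> of_bool (\<tau> \<in> facets \<sigma>))"
    by (auto simp: cls_Some push_def simp_map_def)
  finally show ?thesis .
qed

lemma f0_map_lifts_boundary:
  assumes col: "\<And>c. c \<in> gens K \<Longrightarrow> boundary_column s c" and v: "v \<in> spc (gen_module K l) x"
  shows "gen_map K (l - 1) x (f0_map K s l x v) = boundary K l x (gen_map K l x v)"
proof
  fix \<tau>
  have v0: "v c = 0" if "c \<in> gens_deg K l" "\<not> fst c \<le> x" for c
    using free_spaceD[OF v[unfolded spc_gen_module]] that by blast
  have "gen_map K (l - 1) x (f0_map K s l x v) \<tau> = (\<Sum>g\<in>gens_upto (l - 1) x.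
      \<Sum>c\<in>gens_deg K l. v c * (f0 s g c * of_bool (cls K x (Some g) = Some \<tau>)))"
    unfolding gen_map_apply f0_map_def
    by (intro sum.cong refl) (simp add: mat_map_apply sum_distrib_right mult.assoc)
  also have "\<dots> = (\<Sum>c\<in>gens_deg K l. v c *
      (\<Sum>g\<in>gens_upto (l - 1) x. f0 s g c * of_bool (cls K x (Some g) = Some \<tau>)))"
    by (subst sum.swap) (simp add: sum_distrib_left)
  also have "\<dots> = (\<Sum>c\<in>gens_upto l x. v c *
      (case cls K x (Some c) of None \<Rightarrow> 0 | Some \<sigma> \<Rightarrow> of_bool (\<tau> \<in> facets \<sigma>)))"
  proof (intro sum.mono_neutral_cong_right ballI)
    fix c assume c: "c \<in> gens_upto l x"
    with boundary_column_sum[of c l s x \<tau>] col[of c] gens_deg_subset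
    show "v c * (\<Sum>g\<in>gens_upto (l - 1) x. f0 s g c * of_bool (cls K x (Some g) = Some \<tau>)) =
        v c * (case cls K x (Some c) of None \<Rightarrow> 0 | Some \<sigma> \<Rightarrow> of_bool (\<tau> \<in> facets \<sigma>))"
      by (metis (no_types, lifting) mem_Collect_eq subsetD)
  qed (use v0 in \<open>auto simp: finite_gens_deg\<close>)
  also have "\<dots> = boundary K l x (gen_map K l x v) \<tau>"
    unfolding boundary_apply gen_map_apply using cls_Some_simplices
    by (intro sum_by_class[symmetric] finite_simplices) (auto intro: option.exhaust)
  finally show "gen_map K (l - 1) x (f0_map K s l x v) \<tau> = boundary K l x (gen_map K l x v) \<tau>" .
qed

declare split_paired_All [simp del] split_paired_Ex [simp del]

section \<open>Invariants of the algorithm\<close>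

definition sound_list :: "'p \<Rightarrow> ('v set \<times> ('p, 'v) gen) set \<Rightarrow> bool" where
  "sound_list x L \<longleftrightarrow> finite L \<and>
     (\<forall>\<tau> g. (\<tau>, g) \<in> L \<longrightarrow> Some g \<in> valid_nodes K x \<and> cls K x (Some g) = Some \<tau>)"

definition sound_edges ::
  "('p, 'v) pirep_state \<Rightarrow> 'p \<Rightarrow> ('p rel_id \<times> ('p, 'v) gen option set) set \<Rightarrow> bool" where
  "sound_edges s x E \<longleftrightarrow> finite E \<and> (\<forall>r e. (r, e) \<in> E \<longrightarrow> fst r \<le> x \<and> column_joins s (r, e))"

text \<open>Before merging a simplex may be listed with several generators, so the representative is
  existential here. \<open>single_valued\<close> in \<open>grade_done\<close> later turns it into a
  function.\<close>

definition represented ::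
  "'p \<Rightarrow> ('v set \<times> ('p, 'v) gen) set \<Rightarrow> ('p rel_id \<times> ('p, 'v) gen option set) set \<Rightarrow>
   ('p, 'v) gen \<Rightarrow> bool" where
  "represented x L E g \<longleftrightarrow> (case cls K x (Some g) of
     None \<Rightarrow> (Some g, None) \<in> connected_by E
   | Some \<tau> \<Rightarrow> \<exists>h. (\<tau>, h) \<in> L \<and> (Some g, Some h) \<in> connected_by E)"

text \<open>Only the list and the forest of a finished grade are read by later grades, so its graph
  does not occur.\<close>

definition grade_done :: "('p, 'v) pirep_state \<Rightarrow> 'p \<Rightarrow> bool" where
  "grade_done s x \<longleftrightarrow> sound_list x (L_act s x) \<and> sound_edges s x (edges (F_act s x)) \<and>
     single_valued (L_act s x) \<and>
     (\<forall>g\<in>gens K. fst g \<le> x \<longrightarrow> represented x (L_act s x) (edges (F_act s x)) g) \<and>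
     (\<forall>g\<in>gens K. fst g = x \<longrightarrow> boundary_column s g)"

definition grades_done :: "'p set \<Rightarrow> ('p, 'v) pirep_state \<Rightarrow> bool" where
  "grades_done D s \<longleftrightarrow> sound_relations s \<and> (\<forall>y\<in>D. grade_done s y)"

definition active :: "'p set \<Rightarrow> 'p \<Rightarrow> ('p, 'v) pirep_state \<Rightarrow> bool" where
  "active D x s \<longleftrightarrow> grades_done D s \<and> x \<notin> D \<and>
     sound_list x (L_act s x) \<and> sound_edges s x (edges (G_act s x))"

text \<open>What work at grade \<open>x\<close> must leave alone for \<open>grade_done\<close> to
  persist at the other grades. Columns may be added but not altered; \<open>G_act\<close> is left
  free.\<close>

definition frame :: "'p \<Rightarrow> ('p, 'v) pirep_state \<Rightarrow> ('p, 'v) pirep_state \<Rightarrow> bool" where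
  "frame x s s' \<longleftrightarrow> rels s \<subseteq> rels s' \<and> (\<forall>r\<in>rels s. \<forall>g. p1 s' g r = p1 s g r) \<and>
     (\<forall>y. y \<noteq> x \<longrightarrow> L_act s' y = L_act s y \<and> F_act s' y = F_act s y) \<and>
     (\<forall>g c. fst c \<noteq> x \<longrightarrow> f0 s' g c = f0 s g c)"

section \<open>Preservation of the invariants\<close>

lemma represented_mono:
  "represented x L E g \<Longrightarrow> L \<subseteq> L' \<Longrightarrow> E \<subseteq> E' \<Longrightarrow> represented x L' E' g"
  using connected_by_mono[of E E'] by (auto simp: represented_def split: option.splits)

lemma represented_connected_by:
  "represented x L E g \<Longrightarrow> connected_by E = connected_by E' \<Longrightarrow> represented x L E' g"
  by (cases "cls K x (Some g)") (simp_all add: represented_def)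

lemma frame_refl: "frame x s s"
  by (simp add: frame_def)

lemma frame_trans: "frame x s s' \<Longrightarrow> frame x s' s'' \<Longrightarrow> frame x s s''"
  unfolding frame_def by (metis subsetD subset_trans)

lemma column_joins_frame: "frame x s s' \<Longrightarrow> column_joins s c \<Longrightarrow> column_joins s' c"
  by (cases c) (auto simp: frame_def column_joins_def)

lemma sound_edges_frame: "frame x s s' \<Longrightarrow> sound_edges s y E \<Longrightarrow> sound_edges s' y E"
  unfolding sound_edges_def using column_joins_frame by blast

lemma grade_done_frame:
  assumes "grade_done s y" "frame x s s'" "y \<noteq> x"
  shows "grade_done s' y"
proof -
  have "L_act s' y = L_act s y" "F_act s' y = F_act s y"
    using assms(2,3) by (auto simp: frame_def)
  moreover have "boundary_column s' g" if "boundary_column s g" "fst g = y" for g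
    using that assms(2,3) by (simp add: frame_def boundary_column_def)
  ultimately show ?thesis
    using assms(1) sound_edges_frame[OF assms(2)] unfolding grade_done_def by auto
qed

lemma active_frame:
  assumes "active D x s" "frame x s s'" "sound_relations s'"
    "sound_list x (L_act s' x)" "sound_edges s' x (edges (G_act s' x))"
  shows "active D x s'"
  using assms grade_done_frame[OF _ assms(2)] unfolding active_def grades_done_def by metis

lemma grade_done_complete:
  assumes "grade_done s x"
  shows "complete_relations s x"
proof -
  have "(Some g, map_option (\<lambda>\<tau>. SOME h. (\<tau>, h) \<in> L_act s x) (cls K x (Some g)))
      \<in> connected_by (edges (F_act s x))" if g: "g \<in> gens K" "fst g \<le> x" for g
  proof -
    have r: "represented x (L_act s x) (edges (F_act s x)) g"
      using assms g by (auto simp: grade_done_def)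
    show ?thesis
    proof (cases "cls K x (Some g)")
      case (Some \<tau>)
      then obtain h where h: "(\<tau>, h) \<in> L_act s x" "(Some g, Some h) \<in> connected_by (edges (F_act s x))"
        using r by (auto simp: represented_def)
      then have "(SOME h. (\<tau>, h) \<in> L_act s x) = h"
        using assms by (intro some_equality) (auto simp: grade_done_def single_valued_def)
      with h Some show ?thesis by simp
    qed (use r in \<open>simp add: represented_def\<close>)
  qed
  moreover have "\<forall>(r, e)\<in>edges (F_act s x). fst r \<le> x \<and> column_joins s (r, e)"
    using assms by (auto simp: grade_done_def sound_edges_def)
  ultimately show ?thesis
    unfolding complete_relations_def
    by (intro exI[of _ "edges (F_act s x)"] exI[of _ "\<lambda>\<tau>. SOME h. (\<tau>, h) \<in> L_act s x"]) simp
qed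

section \<open>Adding a relation unless it closes a cycle\<close>

lemma try_relation_exists:
  assumes "sound_relations s"
  shows "\<exists>t. try_relation x a b s t"
proof -
  have "finite (Pair x -` rels s)"
    using assms by (intro finite_vimageI) (auto simp: sound_relations_def inj_on_def)
  then obtain n where "n \<notin> Pair x -` rels s"
    using ex_new_if_finite[OF infinite_UNIV_nat] by blast
  then have "(x, n) \<notin> rels s" by simp
  then show ?thesis unfolding try_relation_def Let_def by blast
qed

lemma try_relation_step:
  assumes act: "active D x s"
    and ab: "a \<in> valid_nodes K x" "b \<in> valid_nodes K x" "a \<noteq> b" "cls K x a = cls K x b"
    and joined: "try_relation x a b s t"
  shows "active D x t" "frame x s t" "L_act t = L_act s" "F_act t = F_act s" "f0 t = f0 s"
    "edges (G_act s x) \<subseteq> edges (G_act t x)" "(a, b) \<in> connected_by (edges (G_act t x))"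
proof -
  let ?E = "edges (G_act s x)"
  obtain n where n: "(x, n) \<notin> rels s"
    and t: "t = (if creates_cycle ?E ((x, n), {a, b}) then s
      else s\<lparr>rels := insert (x, n) (rels s),
        p1 := (\<lambda>g r'. if r' = (x, n) then of_bool (Some g \<in> {a, b}) else p1 s g r'),
        G_act := (G_act s)(x := (G_act s x)\<lparr>edges := insert ((x, n), {a, b}) ?E\<rparr>)\<rparr>)"
    using joined unfolding try_relation_def Let_def by blast
  have "active D x t \<and> frame x s t \<and> L_act t = L_act s \<and> F_act t = F_act s \<and> f0 t = f0 s \<and>
    ?E \<subseteq> edges (G_act t x) \<and> (a, b) \<in> connected_by (edges (G_act t x))"
  proof (cases "creates_cycle ?E ((x, n), {a, b})")
    case True
    from creates_cycle_connected[OF this]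
    obtain c d where "{a, b} = {c, d}" "(c, d) \<in> connected_by ?E" by auto
    then have "(a, b) \<in> connected_by ?E"
      using connected_by_sym by (auto simp: doubleton_eq_iff)
    with True t act show ?thesis by (simp add: frame_refl)
  next
    case False
    with t have t': "rels t = insert (x, n) (rels s)"
      "p1 t = (\<lambda>g r'. if r' = (x, n) then of_bool (Some g \<in> {a, b}) else p1 s g r')"
      "edges (G_act t x) = insert ((x, n), {a, b}) ?E"
      "L_act t = L_act s" "F_act t = F_act s" "f0 t = f0 s" by auto
    \<comment> \<open>The identifier is fresh, so no existing column is overwritten.\<close>
    have fr: "frame x s t" using n by (auto simp: frame_def t')
    have new: "column_joins t ((x, n), {a, b})"
      using ab(3) by (auto simp: column_joins_def t')
    have rel: "sound_relations s" and L: "sound_list x (L_act s x)" and E: "sound_edges s x ?E"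
      using act by (auto simp: active_def grades_done_def)
    have "\<exists>a b. a \<in> valid_nodes K (fst r) \<and> b \<in> valid_nodes K (fst r) \<and>
        cls K (fst r) a = cls K (fst r) b \<and> column_joins t (r, {a, b})" if "r \<in> rels t" for r
    proof (cases "r = (x, n)")
      case True
      with ab new show ?thesis by auto
    next
      case False
      with that have "r \<in> rels s" by (simp add: t')
      then show ?thesis
        using rel column_joins_frame[OF fr] unfolding sound_relations_def by blast
    qed
    then have "sound_relations t"
      using rel by (auto simp: sound_relations_def t')
    moreover have "sound_edges t x (edges (G_act t x))"
      using sound_edges_frame[OF fr E] new by (auto simp: sound_edges_def t')
    ultimately have "active D x t"
      using active_frame[OF act fr] L by (simp add: t')
    then show ?thesis
      using fr by (auto simp: t' intro: connected_by_edge)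
  qed
  then show "active D x t" "frame x s t" "L_act t = L_act s" "F_act t = F_act s" "f0 t = f0 s"
    "edges (G_act s x) \<subseteq> edges (G_act t x)" "(a, b) \<in> connected_by (edges (G_act t x))"
    by auto
qed

text \<open>Edge events record only vertices whose label changes; for all others the default value
  \<open>v\<close> is already the image.\<close>

lemma event_map_eq:
  assumes "y \<prec> x" "{v} \<in> cpx K y"
  shows "event_map K y x v = vmap K y x v"
proof -
  have "{vmap K y x v} \<in> cpx K x"
    using simp_map_cpx[of y x "{v}"] assms by (auto simp: simp_map_def covers_def)
  then have "(y, x, v, w) \<in> edge_events K \<longleftrightarrow> w = vmap K y x v \<and> v \<noteq> w" for w
    using assms by (auto simp: edge_events_def)
  then show ?thesis by (auto simp: event_map_def)
qed

lemma inj_on_event_map: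
  assumes "y \<prec> x" "\<sigma> \<in> cpx K y"
  shows "inj_on (event_map K y x) \<sigma> \<longleftrightarrow> card (simp_map K y x \<sigma>) = card \<sigma>"
proof -
  have "inj_on (event_map K y x) \<sigma> \<longleftrightarrow> inj_on (vmap K y x) \<sigma>"
    using event_map_eq[OF assms(1) cpx_vertex[OF assms(2)]] by (intro inj_on_cong) auto
  also have "\<dots> \<longleftrightarrow> card (simp_map K y x \<sigma>) = card \<sigma>"
    unfolding simp_map_def using cpxD[OF assms(2)] by (auto intro: card_image eq_card_imp_inj_on)
  finally show ?thesis .
qed

subsection \<open>Collapse\<close>

text \<open>\<open>s0\<close> is the state before the collapse, from which the forests and lists of
  the lower grades are read, and \<open>as\<close> consists of the items treated so far. Keeping all
  those forests inside the current graph preserves every earlier path.\<close>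

definition collapsing ::
  "'p set \<Rightarrow> 'p \<Rightarrow> ('p, 'v) pirep_state \<Rightarrow> ('p \<times> 'v set \<times> ('p, 'v) gen) list \<Rightarrow>
   ('p, 'v) pirep_state \<Rightarrow> bool" where
  "collapsing D x s0 as s \<longleftrightarrow> active D x s \<and> frame x s0 s \<and>
     (\<forall>y. y \<prec> x \<longrightarrow> edges (F_act s0 y) \<subseteq> edges (G_act s x)) \<and>
     (\<forall>y \<sigma> g. (y, \<sigma>, g) \<in> set as \<longrightarrow>
        (case push K y x (Some \<sigma>) of
           None \<Rightarrow> (Some g, None) \<in> connected_by (edges (G_act s x))
         | Some \<tau> \<Rightarrow> (\<tau>, g) \<in> L_act s x))"

definition collapsed :: "'p set \<Rightarrow> 'p \<Rightarrow> ('p, 'v) pirep_state \<Rightarrow> bool" where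
  "collapsed D x s \<longleftrightarrow> active D x s \<and>
     (\<forall>g\<in>gens K. fst g < x \<longrightarrow> represented x (L_act s x) (edges (G_act s x)) g)"

context
  fixes D x s
  assumes D: "grades_done D s" "x \<notin> D" "\<And>y. y < x \<Longrightarrow> y \<in> D"
begin

lemma active_item:
  assumes "y \<prec> x" "(\<sigma>, g) \<in> L_act s y"
  shows "\<sigma> \<in> cpx K y" "Some g \<in> valid_nodes K x" "cls K x (Some g) = push K y x (Some \<sigma>)"
proof -
  have y: "y < x" "y \<le> x" using assms by (auto simp: covers_def)
  have "sound_list y (L_act s y)"
    using D(1) D(3)[OF y(1)] by (auto simp: grades_done_def grade_done_def)
  then have g: "Some g \<in> valid_nodes K y" "cls K y (Some g) = Some \<sigma>"
    using assms(2) by (auto simp: sound_list_def)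
  then show "\<sigma> \<in> cpx K y" using cls_Some_cpx[of g y] by (simp add: Some_valid)
  show "Some g \<in> valid_nodes K x" using g(1) valid_nodes_mono[OF y(2)] by blast
  show "cls K x (Some g) = push K y x (Some \<sigma>)" using cls_push[OF g(1) y(2)] g(2) by simp
qed

definition collapse_graph :: "(('p, 'v) gen option, 'p rel_id) graph" where
  "collapse_graph = (if \<exists>y. y \<prec> x
     then \<lparr>nodes = (\<Union>y\<in>{y. y \<prec> x}. nodes (F_act s y)),
           edges = (\<Union>y\<in>{y. y \<prec> x}. edges (F_act s y))\<rparr>
     else \<lparr>nodes = {None}, edges = {}\<rparr>)"

abbreviation "collapse_start \<equiv> s\<lparr>L_act := (L_act s)(x := {}), G_act := (G_act s)(x := collapse_graph)\<rparr>"
abbreviation "items \<equiv> {(y, \<sigma>, g). y \<prec> x \<and> (\<sigma>, g) \<in> L_act s y}"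

lemma collapse_iff:
  "collapse K x s s' \<longleftrightarrow> (\<exists>as. distinct as \<and> set as = items \<and>
     steps (collapse_step K x) as collapse_start s')"
  unfolding collapse_def collapse_graph_def Let_def ..

lemma collapsing_start: "collapsing D x s [] collapse_start"
proof -
  have edges: "edges collapse_graph = (\<Union>y\<in>{y. y \<prec> x}. edges (F_act s y))"
    by (auto simp: collapse_graph_def)
  have fr: "frame x s collapse_start" by (simp add: frame_def)
  have F: "sound_edges s y (edges (F_act s y))" if "y \<prec> x" for y
    using D(1) D(3)[of y] that by (auto simp: grades_done_def grade_done_def covers_def)
  have "sound_edges s x (edges collapse_graph)"
    unfolding sound_edges_def
  proof (intro conjI allI impI)
    show "finite (edges collapse_graph)" using F by (auto simp: edges sound_edges_def)
  next
    fix r e assume "(r, e) \<in> edges collapse_graph"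
    then obtain y where y: "y \<prec> x" "(r, e) \<in> edges (F_act s y)" by (auto simp: edges)
    with F[OF y(1)] have "fst r \<le> y" "column_joins s (r, e)" by (auto simp: sound_edges_def)
    moreover have "y \<le> x" using y by (auto simp: covers_def)
    ultimately show "fst r \<le> x" "column_joins s (r, e)" by auto
  qed
  then have "sound_edges collapse_start x (edges collapse_graph)"
    using sound_edges_frame[OF fr] by blast
  moreover have "sound_relations collapse_start"
    using D(1) by (simp add: grades_done_def sound_relations_def column_joins_def)
  moreover have "grade_done collapse_start y" if "y \<in> D" for y
    using D that by (intro grade_done_frame[OF _ fr]) (auto simp: grades_done_def)
  ultimately have "active D x collapse_start"
    using D(2) by (simp add: active_def grades_done_def sound_list_def)
  then show ?thesis
    using fr by (auto simp: collapsing_def edges)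
qed

lemma collapse_step_exists:
  assumes "collapsing D x s as t"
  shows "\<exists>t'. collapse_step K x a t t'"
proof -
  obtain y \<sigma> g where a: "a = (y, \<sigma>, g)" by (cases a)
  have "sound_relations t" using assms by (simp add: collapsing_def active_def grades_done_def)
  then show ?thesis
    using try_relation_exists[of t x None "Some g"]
    by (cases "inj_on (event_map K y x) \<sigma>") (simp_all add: collapse_step_def a)
qed

text \<open>The test for repeated vertices separates the two cases of \<open>push\<close>. If it
  fails, the generator has class \<open>None\<close> at \<open>x\<close>, like \<Omega>, so joining
  the two is sound.\<close>

lemma collapsing_step:
  assumes "collapsing D x s as t" and a: "a \<in> items" and step: "collapse_step K x a t t'"
  shows "collapsing D x s (as @ [a]) t'"
proof -
  obtain y \<sigma> g where a': "a = (y, \<sigma>, g)" "y \<prec> x" "(\<sigma>, g) \<in> L_act s y" using a by auto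
  note item = active_item[OF a'(2,3)]
  have act: "active D x t" and fr: "frame x s t"
    and F: "\<And>y. y \<prec> x \<Longrightarrow> edges (F_act s y) \<subseteq> edges (G_act t x)"
    and old: "\<And>y \<sigma> g. (y, \<sigma>, g) \<in> set as \<Longrightarrow> (case push K y x (Some \<sigma>) of
           None \<Rightarrow> (Some g, None) \<in> connected_by (edges (G_act t x))
         | Some \<tau> \<Rightarrow> (\<tau>, g) \<in> L_act t x)"
    using assms(1) by (auto simp: collapsing_def)
  have "active D x t' \<and> frame x t t' \<and> edges (G_act t x) \<subseteq> edges (G_act t' x) \<and>
      L_act t x \<subseteq> L_act t' x \<and>
      (case push K y x (Some \<sigma>) of
           None \<Rightarrow> (Some g, None) \<in> connected_by (edges (G_act t' x))
         | Some \<tau> \<Rightarrow> (\<tau>, g) \<in> L_act t' x)"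
  proof (cases "inj_on (event_map K y x) \<sigma>")
    case True
    then have t': "t' = t\<lparr>L_act := (L_act t)(x := insert (simp_map K y x \<sigma>, g) (L_act t x))\<rparr>"
      using step by (simp add: collapse_step_def a')
    have p: "push K y x (Some \<sigma>) = Some (simp_map K y x \<sigma>)"
      using True inj_on_event_map[OF a'(2) item(1)] by (simp add: push_def)
    have fr': "frame x t t'" by (simp add: frame_def t')
    have "sound_relations t'" "sound_edges t' x (edges (G_act t' x))"
      using act sound_edges_frame[OF fr']
      by (auto simp: active_def grades_done_def t' sound_relations_def column_joins_def sound_edges_def)
    moreover have "sound_list x (L_act t' x)"
      using act item p by (auto simp: active_def sound_list_def t')
    ultimately show ?thesis
      using active_frame[OF act fr'] fr' p by (auto simp: t')
  next
    case False
    then have joined: "try_relation x None (Some g) t t'"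
      using step by (simp add: collapse_step_def a')
    have p: "push K y x (Some \<sigma>) = None"
      using False inj_on_event_map[OF a'(2) item(1)] by (simp add: push_def)
    note r = try_relation_step[OF act None_valid item(2) _ _ joined]
    show ?thesis
      using r p item(3) connected_by_sym by auto
  qed
  then have new: "active D x t'" "frame x t t'" "edges (G_act t x) \<subseteq> edges (G_act t' x)"
      "L_act t x \<subseteq> L_act t' x"
      "case push K y x (Some \<sigma>) of
           None \<Rightarrow> (Some g, None) \<in> connected_by (edges (G_act t' x))
         | Some \<tau> \<Rightarrow> (\<tau>, g) \<in> L_act t' x" by auto
  have "case push K y x (Some \<sigma>) of
           None \<Rightarrow> (Some g, None) \<in> connected_by (edges (G_act t' x))
         | Some \<tau> \<Rightarrow> (\<tau>, g) \<in> L_act t' x" if "(y, \<sigma>, g) \<in> set as" for y \<sigma> g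
    using old[OF that] new(4) connected_by_mono[OF new(3)] by (auto split: option.splits)
  then show ?thesis
    unfolding collapsing_def using new frame_trans[OF fr new(2)] F by (auto simp: a') blast+
qed

lemma collapse_exists: "\<exists>s'. collapse K x s s'"
proof -
  have "finite (L_act s y)" if "y \<prec> x" for y
    using D(1) D(3)[of y] that
    by (auto simp: grades_done_def grade_done_def covers_def sound_list_def)
  then have "finite (Sigma {y. y \<prec> x} (L_act s))" by auto
  moreover have "items = Sigma {y. y \<prec> x} (L_act s)" by auto
  ultimately have "finite items" by simp
  then obtain as where as: "set as = items" "distinct as" using finite_distinct_list by blast
  have "\<exists>s'. steps (collapse_step K x) as collapse_start s'"
  proof (rule steps_total[where I = "collapsing D x s"])
    show "collapsing D x s [] collapse_start" by (rule collapsing_start)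
  next
    fix as' a bs t t'
    assume "as = as' @ a # bs" "collapsing D x s as' t" "collapse_step K x a t t'"
    then show "collapsing D x s (as' @ [a]) t'" using as(1) by (intro collapsing_step) auto
  qed (rule collapse_step_exists)
  with as show ?thesis unfolding collapse_iff by blast
qed

text \<open>A generator born below \<open>x\<close> is represented at some covered grade
  \<open>y\<close>. Its path there survives in the new graph, and the item of its representative
  either relists that representative under the image simplex or prolongs the path to
  \<Omega>.\<close>

lemma collapse_collapsed:
  assumes "collapse K x s s'"
  shows "collapsed D x s'"
proof -
  obtain as where as: "set as = items" "steps (collapse_step K x) as collapse_start s'"
    using assms unfolding collapse_iff by blast
  have "collapsing D x s as s'"
    using as(2) collapsing_start
  proof (rule steps_prefix_invariant)
    fix as' a bs t t'
    assume "as = as' @ a # bs" "collapsing D x s as' t" "collapse_step K x a t t'"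
    then show "collapsing D x s (as' @ [a]) t'" using as(1) by (intro collapsing_step) auto
  qed
  then have act: "active D x s'"
    and F: "\<And>y. y \<prec> x \<Longrightarrow> edges (F_act s y) \<subseteq> edges (G_act s' x)"
    and item: "\<And>y \<sigma> g. y \<prec> x \<Longrightarrow> (\<sigma>, g) \<in> L_act s y \<Longrightarrow> (case push K y x (Some \<sigma>) of
           None \<Rightarrow> (Some g, None) \<in> connected_by (edges (G_act s' x))
         | Some \<tau> \<Rightarrow> (\<tau>, g) \<in> L_act s' x)"
    using as(1) by (auto simp: collapsing_def)
  have "represented x (L_act s' x) (edges (G_act s' x)) g" if g: "g \<in> gens K" "fst g < x" for g
  proof -
    obtain y where y: "fst g \<le> y" "y \<prec> x" using covers_between[OF g(2)] by blast
    then have yx: "y < x" "y \<le> x" by (auto simp: covers_def)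
    have r: "represented y (L_act s y) (edges (F_act s y)) g"
      using D(1) D(3)[OF yx(1)] y g by (auto simp: grades_done_def grade_done_def)
    have c: "cls K x (Some g) = push K y x (cls K y (Some g))"
      using g y yx by (intro cls_push) (auto simp: Some_valid)
    note con = subsetD[OF connected_by_mono[OF F[OF y(2)]]]
    show ?thesis
    proof (cases "cls K y (Some g)")
      case None
      then show ?thesis using r c con by (simp add: represented_def)
    next
      case (Some \<sigma>)
      then obtain h where h: "(\<sigma>, h) \<in> L_act s y" "(Some g, Some h) \<in> connected_by (edges (F_act s y))"
        using r by (auto simp: represented_def)
      show ?thesis
        using item[OF y(2) h(1)] con[OF h(2)] c Some
        by (auto simp: represented_def split: option.splits intro: connected_by_trans)
    qed
  qed
  with act show ?thesis by (auto simp: collapsed_def)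
qed

end

subsection \<open>New generators\<close>

definition inserting :: "'p set \<Rightarrow> 'p \<Rightarrow> 'v set list \<Rightarrow> ('p, 'v) pirep_state \<Rightarrow> bool" where
  "inserting D x \<sigma>s s \<longleftrightarrow> collapsed D x s \<and>
     (\<forall>\<sigma>\<in>set \<sigma>s. (\<sigma>, (x, \<sigma>)) \<in> L_act s x \<and> boundary_column s (x, \<sigma>))"

definition generated :: "'p set \<Rightarrow> 'p \<Rightarrow> ('p, 'v) pirep_state \<Rightarrow> bool" where
  "generated D x s \<longleftrightarrow> active D x s \<and>
     (\<forall>g\<in>gens K. fst g \<le> x \<longrightarrow> represented x (L_act s x) (edges (G_act s x)) g) \<and>
     (\<forall>g\<in>gens K. fst g = x \<longrightarrow> boundary_column s g)"

text \<open>A facet is the class of some generator. If that one was born earlier, the collapse has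
  listed a representative of the facet. If it was born at \<open>x\<close>, it is the facet itself,
  of smaller dimension and therefore already inserted.\<close>

lemma insert_generator_exists:
  assumes I: "inserting D x \<sigma>s s" and \<sigma>: "(x, \<sigma>) \<in> gens K"
    and smaller: "\<And>\<tau>. (x, \<tau>) \<in> gens K \<Longrightarrow> simp_dim \<tau> < simp_dim \<sigma> \<Longrightarrow> \<tau> \<in> set \<sigma>s"
  shows "\<exists>s'. insert_generator x \<sigma> s s'"
proof -
  have "\<exists>h. (\<tau>, h) \<in> L_act s x" if \<tau>: "\<tau> \<in> facets \<sigma>" for \<tau>
  proof -
    have "\<tau> \<in> cpx K x" using cpx_facet[OF _ \<tau>] gensD[OF \<sigma>] by simp
    then obtain g where g: "g \<in> gens K" "fst g \<le> x" "cls K x (Some g) = Some \<tau>"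
      using generator_of_simplex by blast
    show ?thesis
    proof (cases "fst g = x")
      case True
      then have "g = (x, \<tau>)" using cls_self[OF g(1)] g(3) by (metis option.inject prod.collapse)
      then have "\<tau> \<in> set \<sigma>s" using smaller g(1) \<tau> by (simp add: facets_def)
      then show ?thesis using I by (auto simp: inserting_def)
    next
      case False
      then have "represented x (L_act s x) (edges (G_act s x)) g"
        using I g by (auto simp: inserting_def collapsed_def)
      then show ?thesis using g(3) by (auto simp: represented_def)
    qed
  qed
  then obtain h where "\<forall>\<tau>\<in>facets \<sigma>. (\<tau>, h \<tau>) \<in> insert (\<sigma>, (x, \<sigma>)) (L_act s x)" by (metis insertCI)
  then show ?thesis unfolding insert_generator_def Let_def by blast
qed

lemma inserting_step:
  assumes I: "inserting D x \<sigma>s s" and \<sigma>: "(x, \<sigma>) \<in> gens K" and step: "insert_generator x \<sigma> s s'"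
  shows "inserting D x (\<sigma>s @ [\<sigma>]) s'"
proof -
  let ?L = "insert (\<sigma>, (x, \<sigma>)) (L_act s x)"
  obtain h where h: "\<And>\<tau>. \<tau> \<in> facets \<sigma> \<Longrightarrow> (\<tau>, h \<tau>) \<in> ?L"
    and s': "s' = s\<lparr>L_act := (L_act s)(x := ?L),
               G_act := (G_act s)(x := (G_act s x)\<lparr>nodes := insert (Some (x, \<sigma>)) (nodes (G_act s x))\<rparr>),
               f0 := (\<lambda>g c. if c = (x, \<sigma>) then of_bool (g \<in> h ` facets \<sigma>) else f0 s g c)\<rparr>"
    using step unfolding insert_generator_def Let_def by blast
  have act: "active D x s" using I by (simp add: inserting_def collapsed_def)
  have fr: "frame x s s'" by (auto simp: frame_def s')
  have L: "sound_list x ?L"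
    using act cls_self[OF \<sigma>] \<sigma> by (auto simp: active_def sound_list_def Some_valid)
  have "sound_relations s'" "sound_edges s' x (edges (G_act s' x))"
    using act sound_edges_frame[OF fr]
    by (auto simp: active_def grades_done_def s' sound_relations_def column_joins_def)
  then have act': "active D x s'" using active_frame[OF act fr] L by (simp add: s')
  have "represented x (L_act s' x) (edges (G_act s' x)) g" if "g \<in> gens K" "fst g < x" for g
  proof (rule represented_mono)
    show "represented x (L_act s x) (edges (G_act s x)) g"
      using I that by (simp add: inserting_def collapsed_def)
  qed (auto simp: s')
  then have col: "collapsed D x s'" using act' by (simp add: collapsed_def)
  have "Some (h \<tau>) \<in> valid_nodes K x \<and> cls K x (Some (h \<tau>)) = Some \<tau>" if "\<tau> \<in> facets \<sigma>" for \<tau>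
    using h[OF that] L unfolding sound_list_def by blast
  then have "boundary_column s' (x, \<sigma>)"
    unfolding boundary_column_def by (intro exI[of _ h]) (simp add: s')
  moreover have "boundary_column s' (x, \<tau>)" if "\<tau> \<in> set \<sigma>s" "\<tau> \<noteq> \<sigma>" for \<tau>
    using I that by (simp add: inserting_def boundary_column_def s')
  ultimately have "\<forall>\<tau>\<in>set (\<sigma>s @ [\<sigma>]). boundary_column s' (x, \<tau>)" by auto
  then show ?thesis
    using I col by (auto simp: inserting_def s')
qed

lemma insert_generators_exists:
  assumes "collapsed D x s"
  shows "\<exists>s'. insert_generators K x s s'"
proof -
  have "finite (snd ` gens K)" using finite_gens by simp
  then have "finite {\<sigma>. (x, \<sigma>) \<in> gens K}" by (rule finite_subset[rotated]) force
  then obtain ys where ys: "set ys = {\<sigma>. (x, \<sigma>) \<in> gens K}" "distinct ys"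
    using finite_distinct_list by blast
  define \<sigma>s where "\<sigma>s = sort_key simp_dim ys"
  have \<sigma>s: "set \<sigma>s = {\<sigma>. (x, \<sigma>) \<in> gens K}" "distinct \<sigma>s" "sorted (map simp_dim \<sigma>s)"
    using ys by (auto simp: \<sigma>s_def)
  have "\<exists>s'. steps (insert_generator x) \<sigma>s s s'"
  proof (rule steps_total[where I = "inserting D x"])
    show "inserting D x [] s" using assms by (simp add: inserting_def)
  next
    fix as \<sigma> bs t t'
    assume "\<sigma>s = as @ \<sigma> # bs" "inserting D x as t" "insert_generator x \<sigma> t t'"
    then show "inserting D x (as @ [\<sigma>]) t'" using \<sigma>s(1) by (intro inserting_step) auto
  next
    fix as \<sigma> bs t
    assume *: "\<sigma>s = as @ \<sigma> # bs" and I: "inserting D x as t"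
    \<comment> \<open>In a list sorted by dimension nothing of smaller dimension than \<sigma> can
      follow it.\<close>
    have "\<tau> \<in> set as" if "(x, \<tau>) \<in> gens K" "simp_dim \<tau> < simp_dim \<sigma>" for \<tau>
    proof -
      have "\<tau> \<in> set as \<union> {\<sigma>} \<union> set bs" using that(1) \<sigma>s(1) * by auto
      then show ?thesis using \<sigma>s(3) that(2) by (auto simp: * sorted_append)
    qed
    moreover have "(x, \<sigma>) \<in> gens K" using \<sigma>s(1) * by auto
    ultimately show "\<exists>t'. insert_generator x \<sigma> t t'" using insert_generator_exists[OF I] by blast
  qed
  with \<sigma>s show ?thesis unfolding insert_generators_def by blast
qed

lemma insert_generators_generated:
  assumes "collapsed D x s" "insert_generators K x s s'"
  shows "generated D x s'"
proof -
  obtain \<sigma>s where \<sigma>s: "set \<sigma>s = {\<sigma>. (x, \<sigma>) \<in> gens K}" "steps (insert_generator x) \<sigma>s s s'"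
    using assms(2) unfolding insert_generators_def by blast
  have "inserting D x \<sigma>s s'"
    using \<sigma>s(2)
  proof (rule steps_prefix_invariant)
    show "inserting D x [] s" using assms by (simp add: inserting_def)
  next
    fix as \<sigma> bs t t'
    assume "\<sigma>s = as @ \<sigma> # bs" "inserting D x as t" "insert_generator x \<sigma> t t'"
    then show "inserting D x (as @ [\<sigma>]) t'" using \<sigma>s(1) by (intro inserting_step) auto
  qed
  then have c: "collapsed D x s'"
    and new: "\<And>\<sigma>. (x, \<sigma>) \<in> gens K \<Longrightarrow> (\<sigma>, (x, \<sigma>)) \<in> L_act s' x \<and> boundary_column s' (x, \<sigma>)"
    using \<sigma>s(1) by (auto simp: inserting_def)
  have "represented x (L_act s' x) (edges (G_act s' x)) g \<and> (fst g = x \<longrightarrow> boundary_column s' g)"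
    if g: "g \<in> gens K" "fst g \<le> x" for g
  proof (cases "fst g = x")
    case True
    then obtain \<sigma> where \<sigma>: "g = (x, \<sigma>)" by (cases g) auto
    then have "(\<sigma>, g) \<in> L_act s' x" "boundary_column s' g" using new g(1) by auto
    with \<sigma> cls_self[OF g(1)] show ?thesis by (auto simp: represented_def)
  next
    case False
    with g c show ?thesis by (auto simp: collapsed_def)
  qed
  with c show ?thesis by (auto simp: generated_def collapsed_def)
qed

subsection \<open>Merging and choice of a forest\<close>

text \<open>After the merge \<open>g\<close> and \<open>g'\<close> are connected, whether or not the
  edge was added. Whatever \<open>g'\<close> represented is then represented by \<open>g\<close>,
  which stays listed.\<close>

lemma generated_merge_step:
  assumes gen: "generated D x s" and step: "merge_step x s s'"
  shows "generated D x s'" "card (L_act s' x) < card (L_act s x)"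
proof -
  obtain \<sigma> g g' t where L: "(\<sigma>, g) \<in> L_act s x" "(\<sigma>, g') \<in> L_act s x" "g \<noteq> g'"
    and joined: "try_relation x (Some g) (Some g') s t"
    and s': "s' = t\<lparr>L_act := (L_act t)(x := L_act t x - {(\<sigma>, g')})\<rparr>"
    using step unfolding merge_step_def by blast
  have act: "active D x s" using gen by (simp add: generated_def)
  then have sound: "sound_list x (L_act s x)" by (simp add: active_def)
  then have "Some g \<in> valid_nodes K x" "Some g' \<in> valid_nodes K x"
    "cls K x (Some g) = cls K x (Some g')"
    using L by (auto simp: sound_list_def)
  note t = try_relation_step[OF act this(1,2) _ this(3) joined]
  have ne: "Some g \<noteq> Some g'" using L(3) by simp
  note t = t[OF ne]
  have fr: "frame x t s'" by (simp add: frame_def s')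
  have "sound_relations s'" "sound_edges s' x (edges (G_act s' x))"
    using t(1) sound_edges_frame[OF fr]
    by (auto simp: active_def grades_done_def s' sound_relations_def column_joins_def)
  moreover have "sound_list x (L_act s' x)"
    using t(1) by (auto simp: active_def sound_list_def s')
  ultimately have act': "active D x s'" using active_frame[OF t(1) fr] by blast
  have "represented x (L_act s' x) (edges (G_act s' x)) h" if h: "h \<in> gens K" "fst h \<le> x" for h
  proof -
    have "represented x (L_act t x) (edges (G_act t x)) h"
    proof (rule represented_mono)
      show "represented x (L_act s x) (edges (G_act s x)) h"
        using gen h by (simp add: generated_def)
    qed (use t(3,6) in auto)
    moreover have "(\<sigma>, g) \<in> L_act s' x" using L t(3) by (simp add: s')
    moreover have "L_act t x \<subseteq> insert (\<sigma>, g') (L_act s' x)" "G_act s' = G_act t"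
      by (auto simp: s')
    ultimately show ?thesis
      using connected_by_trans[OF _ connected_by_sym[OF t(7)]]
      by (auto simp: represented_def split: option.splits)
  qed
  moreover have "boundary_column s' h" if "h \<in> gens K" "fst h = x" for h
    using gen that t(5) by (simp add: generated_def boundary_column_def s')
  ultimately show "generated D x s'" using act' by (simp add: generated_def)
  show "card (L_act s' x) < card (L_act s x)"
    using L(2) t(3) sound card_Diff1_less[of "L_act s x"] by (simp add: s' sound_list_def)
qed

lemma merge_all_generated:
  assumes "generated D x s" "merge_all x s s'"
  shows "generated D x s'" "single_valued (L_act s' x)"
proof -
  have "(merge_step x)\<^sup>*\<^sup>* s s'" using assms(2) by (simp add: merge_all_def)
  then show "generated D x s'"
    using assms(1) by (induction rule: rtranclp_induct) (auto dest: generated_merge_step)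
  show "single_valued (L_act s' x)"
    using assms(2) unfolding merge_all_def single_valued_def by blast
qed

text \<open>Each merge removes an entry from a finite list, so any sequence of merges ends.\<close>

lemma merge_all_exists:
  assumes "generated D x s"
  shows "\<exists>s'. merge_all x s s'"
  using assms
proof (induction "card (L_act s x)" arbitrary: s rule: less_induct)
  case less
  show ?case
  proof (cases "\<forall>\<sigma> g g'. (\<sigma>, g) \<in> L_act s x \<and> (\<sigma>, g') \<in> L_act s x \<longrightarrow> g = g'")
    case True
    then have "merge_all x s s" unfolding merge_all_def by blast
    then show ?thesis by blast
  next
    case False
    then obtain \<sigma> g g' where L: "(\<sigma>, g) \<in> L_act s x" "(\<sigma>, g') \<in> L_act s x" "g \<noteq> g'" by blast
    have "sound_relations s" using less.prems by (simp add: generated_def active_def grades_done_def)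
    then obtain t where "try_relation x (Some g) (Some g') s t" using try_relation_exists by blast
    with L obtain s1 where s1: "merge_step x s s1" unfolding merge_step_def by blast
    then obtain s' where "merge_all x s1 s'"
      using less.hyps generated_merge_step[OF less.prems s1] by blast
    then have "merge_all x s s'"
      using s1 unfolding merge_all_def by (meson converse_rtranclp_into_rtranclp)
    then show ?thesis by blast
  qed
qed

lemma choose_forest_exists:
  assumes "generated D x s"
  shows "\<exists>s'. choose_forest x s s'"
proof -
  have "finite (edges (G_act s x))"
    using assms by (simp add: generated_def active_def sound_edges_def)
  then show ?thesis
    using spanning_forest_exists unfolding choose_forest_def by blast
qed

lemma choose_forest_done:
  assumes gen: "generated D x s" and sv: "single_valued (L_act s x)" and "choose_forest x s s'"
  shows "grades_done (insert x D) s'"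
proof -
  obtain F where F: "spanning_forest F (G_act s x)" and s': "s' = s\<lparr>F_act := (F_act s)(x := F)\<rparr>"
    using assms(3) unfolding choose_forest_def by blast
  have FE: "edges F \<subseteq> edges (G_act s x)" "connected_by (edges F) = connected_by (edges (G_act s x))"
    using F by (auto simp: spanning_forest_def)
  have act: "active D x s" using gen by (simp add: generated_def)
  have fr: "frame x s s'" by (simp add: frame_def s')
  have "sound_edges s x (edges F)"
    using act FE(1) unfolding active_def sound_edges_def by (meson finite_subset subsetD)
  then have "sound_edges s' x (edges (F_act s' x))"
    using sound_edges_frame[OF fr] by (simp add: s')
  moreover have "represented x (L_act s' x) (edges (F_act s' x)) g" if "g \<in> gens K" "fst g \<le> x" for g
    using gen that represented_connected_by[OF _ FE(2)[symmetric]] by (simp add: generated_def s')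
  moreover have "boundary_column s' g" if "g \<in> gens K" "fst g = x" for g
    using gen that by (simp add: generated_def boundary_column_def s')
  ultimately have "grade_done s' x"
    using act sv by (simp add: grade_done_def active_def s')
  moreover have "grade_done s' y" if "y \<in> D" for y
    using act that by (intro grade_done_frame[OF _ fr]) (auto simp: active_def grades_done_def)
  moreover have "sound_relations s'"
    using act by (simp add: active_def grades_done_def sound_relations_def column_joins_def s')
  ultimately show ?thesis by (simp add: grades_done_def)
qed

subsection \<open>Correctness along a linear extension\<close>

lemma process_grade_exists:
  assumes "grades_done D s" "x \<notin> D" "\<And>y. y < x \<Longrightarrow> y \<in> D"
  shows "\<exists>s'. process_grade K x s s'"
proof -
  obtain s1 where s1: "collapse K x s s1" using collapse_exists[OF assms] by blast
  note c = collapse_collapsed[OF assms s1]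
  obtain s2 where s2: "insert_generators K x s1 s2" using insert_generators_exists[OF c] by blast
  note g = insert_generators_generated[OF c s2]
  obtain s3 where s3: "merge_all x s2 s3" using merge_all_exists[OF g] by blast
  obtain s4 where "choose_forest x s3 s4"
    using choose_forest_exists[OF merge_all_generated(1)[OF g s3]] by blast
  with s1 s2 s3 show ?thesis unfolding process_grade_def by blast
qed

lemma process_grade_done:
  assumes "grades_done D s" "x \<notin> D" "\<And>y. y < x \<Longrightarrow> y \<in> D" and "process_grade K x s s'"
  shows "grades_done (insert x D) s'"
proof -
  obtain s1 s2 s3 where "collapse K x s s1" "insert_generators K x s1 s2" "merge_all x s2 s3"
    "choose_forest x s3 s'"
    using assms(4) unfolding process_grade_def by blast
  then show ?thesis
    using choose_forest_done merge_all_generated insert_generators_generated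
      collapse_collapsed[OF assms(1-3)] by blast
qed

lemma grades_done_init: "grades_done {} init_state"
  by (simp add: grades_done_def sound_relations_def init_state_def)

text \<open>A prefix of a linear extension is closed downwards: nothing below \<open>x\<close> may
  stand after it. So every grade that the collapse reads is finished.\<close>

lemma linear_extension_prefix:
  assumes "linear_extension (as @ x # bs)"
  shows "x \<notin> set as" "y < x \<Longrightarrow> y \<in> set as"
proof -
  show "x \<notin> set as" using assms by (auto simp: linear_extension_def)
  assume "y < x"
  moreover have "y \<in> set (as @ x # bs)" using assms by (auto simp: linear_extension_def)
  ultimately show "y \<in> set as"
    using assms by (auto simp: linear_extension_def sorted_wrt_append)
qed

lemma grades_done_step:
  assumes "linear_extension zs" "zs = as @ x # bs" "grades_done (set as) s" "process_grade K x s s'"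
  shows "grades_done (set (as @ [x])) s'"
  using process_grade_done[OF assms(3) _ _ assms(4)] linear_extension_prefix[of as x bs] assms(1,2)
  by auto

lemma pirep_exists:
  assumes "linear_extension zs"
  shows "\<exists>s. pirep K zs s"
proof -
  have "\<exists>s. steps (process_grade K) zs init_state s"
  proof (rule steps_total[where I = "\<lambda>as. grades_done (set as)"])
    fix as x bs s
    assume "zs = as @ x # bs" "grades_done (set as) s"
    then show "\<exists>s'. process_grade K x s s'"
      using linear_extension_prefix[of as x bs] assms by (intro process_grade_exists) auto
  qed (use assms grades_done_step grades_done_init in \<open>simp_all\<close>)
  with assms show ?thesis by (auto simp: pirep_def)
qed

lemma pirep_done:
  assumes "pirep K zs s"
  shows "grades_done UNIV s"
proof -
  have zs: "linear_extension zs" "steps (process_grade K) zs init_state s"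
    using assms by (auto simp: pirep_def)
  have "grades_done (set zs) s"
    using zs(2) by (rule steps_prefix_invariant[where I = "\<lambda>as. grades_done (set as)"])
      (use zs(1) grades_done_step grades_done_init in \<open>simp_all\<close>)
  with zs(1) show ?thesis by (simp add: linear_extension_def)
qed

end

theorem theorem36:
  fixes K :: "('p::{finite,order}, 'v) tower"
  assumes "poset_tower K"
  shows "(\<forall>zs. linear_extension zs \<longrightarrow> (\<exists>s. pirep K zs s)) \<and>
    (\<forall>zs s l. pirep K zs s \<longrightarrow>
       exact_presentation (chain_module K l) (gen_map K l) (gen_module K l)
         (p1_map K s l) (rel_module K s l) \<and>
       projective (gen_module K l) \<and> projective (rel_module K s l) \<and>
       morphism (gen_module K l) (gen_module K (l - 1)) (f0_map K s l) \<and>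
       (\<forall>x. \<forall>v\<in>spc (gen_module K l) x.
          gen_map K (l - 1) x (f0_map K s l x v) = boundary K l x (gen_map K l x v)))"
proof -
  interpret tower_context K by unfold_locales (rule assms)
  show ?thesis
  proof (intro conjI allI impI ballI)
    fix zs :: "'p list"
    assume "linear_extension zs"
    then show "\<exists>s. pirep K zs s" by (rule pirep_exists)
  next
    fix zs s l
    assume "pirep K zs s"
    then have fin: "grades_done UNIV s" by (rule pirep_done)
    then have sound: "sound_relations s" and grade: "\<And>x. grade_done s x"
      by (auto simp: grades_done_def)
    have col: "boundary_column s c" if "c \<in> gens K" for c
      using grade[of "fst c"] that by (auto simp: grade_done_def)
    show "exact_presentation (chain_module K l) (gen_map K l) (gen_module K l)
        (p1_map K s l) (rel_module K s l)"
      using sound grade_done_complete[OF grade] by (rule exact_presentation_relations)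
    show "projective (gen_module K l)"
      by (simp add: gen_module_def projective_proj_sum finite_gens_deg)
    show "projective (rel_module K s l)"
      by (simp add: rel_module_def projective_proj_sum finite_rels_deg[OF sound])
    show "morphism (gen_module K l) (gen_module K (l - 1)) (f0_map K s l)"
      using col by (rule morphism_f0_map)
    show "gen_map K (l - 1) x (f0_map K s l x v) = boundary K l x (gen_map K l x v)"
      if "v \<in> spc (gen_module K l) x" for x v
      using col that by (rule f0_map_lifts_boundary)
  qed
qed

end
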